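(* Let $n\ge1$ and let $\varphi:\mathbb{H}^n\to\mathbb{R}$ be a strictly $H$-convex function. The following are equivalent: (i) $\varphi$ satisfies the engulfing property $E(H,K)$ for some $K>1$; (ii) there exists $K'>1$ such that for every $\xi,\xi'\in\mathbb{H}^n$, $p\in\partial_H\varphi(\xi)$, $q\in\partial_H\varphi(\xi')$ and $s>0$, if $\xi'\in S_\varphi^H(\xi,p,s)$ then $\xi\in S_\varphi^H(\xi',q,K's)$; (iii) there exists a constant $K''>1$ such that, for any $\xi\in\mathbb{H}^n$, $\xi'\in H_\xi$, and for any $p\in\partial_H\varphi(\xi)$ and $q\in\partial_H\varphi(\xi')$, $$\frac{K''+1}{K''}\bigl(\varphi(\xi')-\varphi(\xi)-p\cdot(\mathrm{Pr}_1(\xi')-\mathrm{Pr}_1(\xi))\bigr)\le(q-p)\cdot(\mathrm{Pr}_1(\xi')-\mathrm{Pr}_1(\xi))\le(K''+1)\bigl(\varphi(\xi')-\varphi(\xi)-p\cdot(\mathrm{Pr}_1(\xi')-\mathrm{Pr}_1(\xi))\bigr).$$ In particular, if any of the conditions above holds, $\varphi$ is $H$-differentiable.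
   Context: Heisenberg group: $\mathbb{H}^n=\mathbb{R}^n\times\mathbb{R}^n\times\mathbb{R}$ with group law $(x,y,t)\circ(x',y',t')=(x+x',y+y',t+t'+2(x'\cdot y-x\cdot y'))$, neutral element $e$, dilations $\delta_\lambda(x,y,t)=(\lambda x,\lambda y,\lambda^2t)$, $\mathrm{Pr}_1(x,y,t)=(x,y)\in\mathbb{R}^{2n}$, and gauge norm $\|(x,y,t)\|_g=((\|x\|^2+\|y\|^2)^2+t^2)^{1/4}$. The horizontal plane at $\xi_0=(x_0,y_0,t_0)$ is $H_{\xi_0}=\{(x,y,t):\ t=t_0+2(y_0\cdot x-x_0\cdot y)\}$. $H$-convexity: $\varphi:\mathbb{H}^n\to\mathbb{R}$ is $H$-convex if $\varphi(\xi_1\circ\delta_\lambda(\xi_1^{-1}\circ\xi_2))\le(1-\lambda)\varphi(\xi_1)+\lambda\varphi(\xi_2)$ for all $\xi_1\in\mathbb{H}^n$, $\xi_2\in H_{\xi_1}$, $\lambda\in[0,1]$; it is strictly $H$-convex if the inequality is strict whenever $\xi_1\ne\xi_2$ and $\lambda\in(0,1)$. Horizontal subdifferential: $\partial_H\varphi(\xi_0)=\{p\in\mathbb{R}^{2n}:\ \varphi(\xi)\ge\varphi(\xi_0)+p\cdot(\mathrm{Pr}_1(\xi)-\mathrm{Pr}_1(\xi_0))\ \forall\xi\in H_{\xi_0}\}$ (nonempty at every point when $\varphi$ is $H$-convex). $\varphi$ is $H$-differentiable if at every $\xi$ there is $\nabla_H\varphi(\xi)\in\mathbb{R}^{2n}$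 with $\varphi(\xi\circ\xi')=\varphi(\xi)+\nabla_H\varphi(\xi)\cdot\mathrm{Pr}_1(\xi')+o(\|\xi'\|_g)$ as $\xi'\to e$. $H$-sections: for $\varphi$ $H$-convex, $p_0\in\partial_H\varphi(\xi_0)$, $s>0$, $S_\varphi^H(\xi_0,p_0,s)=\{\xi\in H_{\xi_0}:\ \varphi(\xi)-\varphi(\xi_0)-p_0\cdot(\mathrm{Pr}_1(\xi)-\mathrm{Pr}_1(\xi_0))<s\}$. Engulfing property $E(H,K)$ ($K>1$): for all $\xi\in\mathbb{H}^n$, $p\in\partial_H\varphi(\xi)$, $s>0$, if $\xi'\in S_\varphi^H(\xi,p,s)$ then $S_\varphi^H(\xi,p,s)\cap H_{\xi'}\subset S_\varphi^H(\xi',q,Ks)\cap H_\xi$ for every $q\in\partial_H\varphi(\xi')$. *)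

theory Defs
  imports "HOL-Analysis.Analysis" "HOL-Library.Landau_Symbols"
begin

(* The dimension n is CARD('n), hence n >= 1.  Heisenberg points are triples (x, y, t), horizontal
   vectors (elements of R^(2n)) are pairs (x, y) with the inner product of the product space. *)

type_synonym 'n heis = "(real ^ 'n) \<times> (real ^ 'n) \<times> real"
type_synonym 'n hvec = "(real ^ 'n) \<times> (real ^ 'n)"

fun hmult :: "'n::finite heis \<Rightarrow> 'n heis \<Rightarrow> 'n heis" (infixl "\<odot>" 70) where
  "(x, y, t) \<odot> (x', y', t') = (x + x', y + y', t + t' + 2 * (x' \<bullet> y - x \<bullet> y'))"

definition he :: "'n::finite heis" where
  "he = (0, 0, 0)"

fun hinv :: "'n::finite heis \<Rightarrow> 'n heis" where
  "hinv (x, y, t) = (- x, - y, - t)"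

lemma hmult_assoc: "(a \<odot> b) \<odot> c = a \<odot> (b \<odot> c)"
  by (cases a; cases b; cases c) (simp add: inner_simps algebra_simps)

lemma hmult_he: "he \<odot> a = a" "a \<odot> he = a"
  by (cases a; simp add: he_def)+

lemma hmult_hinv: "hinv a \<odot> a = he" "a \<odot> hinv a = he"
  by (cases a; simp add: he_def inner_commute)+

fun dil :: "real \<Rightarrow> 'n::finite heis \<Rightarrow> 'n heis" where
  "dil l (x, y, t) = (l *\<^sub>R x, l *\<^sub>R y, l\<^sup>2 * t)"

fun Pr1 :: "'n::finite heis \<Rightarrow> 'n hvec" where
  "Pr1 (x, y, t) = (x, y)"

fun gauge_norm :: "'n::finite heis \<Rightarrow> real" where
  "gauge_norm (x, y, t) = root 4 (((norm x)\<^sup>2 + (norm y)\<^sup>2)\<^sup>2 + t\<^sup>2)"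

fun hplane :: "'n::finite heis \<Rightarrow> 'n heis set" where
  "hplane (x0, y0, t0) = {(x, y, t). t = t0 + 2 * (y0 \<bullet> x - x0 \<bullet> y)}"

definition H_convex :: "('n::finite heis \<Rightarrow> real) \<Rightarrow> bool" where
  "H_convex \<phi> \<longleftrightarrow> (\<forall>\<xi>1. \<forall>\<xi>2\<in>hplane \<xi>1. \<forall>l\<in>{0..1}.
     \<phi> (\<xi>1 \<odot> dil l (hinv \<xi>1 \<odot> \<xi>2)) \<le> (1 - l) * \<phi> \<xi>1 + l * \<phi> \<xi>2)"

definition strictly_H_convex :: "('n::finite heis \<Rightarrow> real) \<Rightarrow> bool" where
  "strictly_H_convex \<phi> \<longleftrightarrow> H_convex \<phi> \<and> (\<forall>\<xi>1. \<forall>\<xi>2\<in>hplane \<xi>1. \<forall>l\<in>{0<..<1}. \<xi>1 \<noteq> \<xi>2 \<longrightarrow>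
     \<phi> (\<xi>1 \<odot> dil l (hinv \<xi>1 \<odot> \<xi>2)) < (1 - l) * \<phi> \<xi>1 + l * \<phi> \<xi>2)"

definition H_subdiff :: "('n::finite heis \<Rightarrow> real) \<Rightarrow> 'n heis \<Rightarrow> 'n hvec set" where
  "H_subdiff \<phi> \<xi>0 = {p. \<forall>\<xi>\<in>hplane \<xi>0. \<phi> \<xi> \<ge> \<phi> \<xi>0 + p \<bullet> (Pr1 \<xi> - Pr1 \<xi>0)}"

definition H_differentiable :: "('n::finite heis \<Rightarrow> real) \<Rightarrow> bool" where
  "H_differentiable \<phi> \<longleftrightarrow> (\<forall>\<xi>. \<exists>g :: 'n hvec.
     (\<lambda>\<xi>'. \<phi> (\<xi> \<odot> \<xi>') - \<phi> \<xi> - g \<bullet> Pr1 \<xi>') \<in> o[at he](gauge_norm))"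

definition H_section :: "('n::finite heis \<Rightarrow> real) \<Rightarrow> 'n heis \<Rightarrow> 'n hvec \<Rightarrow> real \<Rightarrow> 'n heis set" where
  "H_section \<phi> \<xi>0 p0 s = {\<xi>\<in>hplane \<xi>0. \<phi> \<xi> - \<phi> \<xi>0 - p0 \<bullet> (Pr1 \<xi> - Pr1 \<xi>0) < s}"

definition engulfing :: "('n::finite heis \<Rightarrow> real) \<Rightarrow> real \<Rightarrow> bool" where
  "engulfing \<phi> K \<longleftrightarrow> (\<forall>\<xi>. \<forall>p\<in>H_subdiff \<phi> \<xi>. \<forall>s>0. \<forall>\<xi>'\<in>H_section \<phi> \<xi> p s. \<forall>q\<in>H_subdiff \<phi> \<xi>'.
     H_section \<phi> \<xi> p s \<inter> hplane \<xi>' \<subseteq> H_section \<phi> \<xi>' q (K * s) \<inter> hplane \<xi>)"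

end

(* The equivalences rest on the Bregman gap gap xi p zeta = phi zeta - phi xi - p . (Pr1 zeta - Pr1 xi):
   (ii) and (iii) both say that it is symmetric up to a constant, and (i) follows from (iii) by
   passing through a subgradient at the midpoint of two points of a section.

   An H-convex function is bounded above near every point: the set where it is controlled grows
   from horizontal segments to vertical ones, then to boxes, because SUP_s phi (exp (s v) o b)
   is again H-convex in b. Reflection gives a lower bound, and convexity along horizontal lines then gives
   Lipschitz estimates and continuity.

   Subgradients exist because phi is touched from below, at points arbitrarily near xi, by a multiple
   of - |zeta - xi|^2, whose horizontal derivative at the touching point is a subgradient; one passes
   to the limit. Under (iii) they are unique, hence continuous in the base point, and telescoping over
   four horizontal moves of length at most twice the gauge norm gives H-differentiability. *)

theory Submission
  imports Defs
begin

section \<open>Horizontal lines and convexity along them\<close>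

text \<open>The points \<open>a \<odot> hexp h\<close> sweep out the horizontal plane at
  \<open>a\<close>, so conditions on planes become statements about free vectors
  \<open>h\<close>.\<close>

definition hexp :: "'n::finite hvec \<Rightarrow> 'n heis" where
  "hexp w = (fst w, snd w, 0)"

definition vert :: "real \<Rightarrow> 'n::finite heis" where
  "vert t = (0, 0, t)"

lemma hmult_eq:
  "a \<odot> b = (fst a + fst b, fst (snd a) + fst (snd b),
     snd (snd a) + snd (snd b) + 2 * (fst b \<bullet> fst (snd a) - fst a \<bullet> fst (snd b)))"
  by (cases a; cases b) simp

lemma hmult_hexp_eq:
  "a \<odot> hexp h = (fst a + fst h, fst (snd a) + snd h,
     snd (snd a) + 2 * (fst h \<bullet> fst (snd a) - fst a \<bullet> snd h))"
  by (simp add: hmult_eq hexp_def)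

lemma Pr1_eq: "Pr1 a = (fst a, fst (snd a))"
  by (cases a) simp

lemma Pr1_hmult [simp]: "Pr1 (a \<odot> b) = Pr1 a + Pr1 b"
  by (simp add: Pr1_eq hmult_eq)

lemma Pr1_hexp [simp]: "Pr1 (hexp h) = h"
  by (simp add: Pr1_eq hexp_def)

lemma hexp_0 [simp]: "hexp 0 = he"
  by (simp add: hexp_def he_def)

text \<open>Parallel horizontal vectors have zero symplectic product, so the twist of the group law
  disappears.\<close>

lemma hexp_add_scaled: "hexp (s *\<^sub>R v) \<odot> hexp (t *\<^sub>R v) = hexp ((s + t) *\<^sub>R v)"
  by (simp add: hexp_def scaleR_add_left inner_commute algebra_simps)

lemma hmult_hexp_hexp_scaled:
  "a \<odot> hexp (s *\<^sub>R v) \<odot> hexp (t *\<^sub>R v) = a \<odot> hexp ((s + t) *\<^sub>R v)"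
  by (simp only: hmult_assoc hexp_add_scaled)

lemma hmult_hexp_cancel [simp]:
  "a \<odot> hexp h \<odot> hexp (- h) = a" "a \<odot> hexp (- h) \<odot> hexp h = a"
  using hmult_hexp_hexp_scaled[of a 1 h "-1"] hmult_hexp_hexp_scaled[of a "-1" h 1]
  by (simp_all add: hmult_he)

lemma hmult_hinv_cancel [simp]: "a \<odot> (hinv a \<odot> b) = b" "hinv a \<odot> (a \<odot> b) = b"
  by (simp_all add: hmult_assoc[symmetric] hmult_hinv hmult_he)

lemma hinv_he: "hinv he = he"
  by (simp add: he_def)

lemma vert_commute: "vert t \<odot> a = a \<odot> vert t"
  by (cases a) (simp add: vert_def)

text \<open>The plane is a graph over the horizontal coordinates, so its points are determined by
  their projections.\<close>

lemma hplane_iff: "b \<in> hplane a \<longleftrightarrow> b = a \<odot> hexp (Pr1 b - Pr1 a)"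
  by (cases a; cases b) (auto simp: hexp_def inner_diff_left inner_diff_right inner_commute)

lemma hmult_hexp_in_hplane [simp]: "a \<odot> hexp h \<in> hplane a"
  by (simp add: hplane_iff)

lemma hplaneE:
  assumes "b \<in> hplane a"
  obtains h where "b = a \<odot> hexp h"
  using assms hplane_iff by blast

lemma dil_hexp [simp]: "dil l (hexp h) = hexp (l *\<^sub>R h)"
  by (simp add: hexp_def)

text \<open>For \<open>\<xi>2 = \<xi>1 \<odot> hexp h\<close> the factor
  \<open>hinv \<xi>1 \<odot> \<xi>2\<close> is \<open>hexp h\<close>, and the dilation only scales
  \<open>h\<close>. What remains is ordinary convexity along horizontal lines.\<close>

lemma H_convex_iff:
  "H_convex \<phi> \<longleftrightarrow> (\<forall>a h l. 0 \<le> l \<longrightarrow> l \<le> 1 \<longrightarrow>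
     \<phi> (a \<odot> hexp (l *\<^sub>R h)) \<le> (1 - l) * \<phi> a + l * \<phi> (a \<odot> hexp h))"
  (is "_ \<longleftrightarrow> ?R")
proof
  assume H: "H_convex \<phi>"
  show ?R
  proof (intro allI impI)
    fix a h and l :: real assume "0 \<le> l" "l \<le> 1"
    then show "\<phi> (a \<odot> hexp (l *\<^sub>R h)) \<le> (1 - l) * \<phi> a + l * \<phi> (a \<odot> hexp h)"
      using H[unfolded H_convex_def, rule_format, of "a \<odot> hexp h" a l] by simp
  qed
next
  assume R: ?R
  show "H_convex \<phi>"
    unfolding H_convex_def
  proof (intro allI ballI)
    fix a b :: "'a heis" and l :: real
    assume b: "b \<in> hplane a" and l: "l \<in> {0..1}"
    obtain h where "b = a \<odot> hexp h" using b by (rule hplaneE)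
    then show "\<phi> (a \<odot> dil l (hinv a \<odot> b)) \<le> (1 - l) * \<phi> a + l * \<phi> b"
      using R[rule_format, of l a h] l by simp
  qed
qed

lemma H_convexD:
  assumes "H_convex \<phi>" "0 \<le> l" "l \<le> 1"
  shows "\<phi> (a \<odot> hexp (l *\<^sub>R h)) \<le> (1 - l) * \<phi> a + l * \<phi> (a \<odot> hexp h)"
  using assms unfolding H_convex_iff by blast

text \<open>Left translations carry horizontal lines to horizontal lines.\<close>

lemma H_convex_left_translate:
  assumes "H_convex \<phi>"
  shows "H_convex (\<lambda>\<xi>. \<phi> (a \<odot> \<xi>))"
  using assms unfolding H_convex_iff hmult_assoc[symmetric] by blast

lemma H_convex_le_max:
  assumes H: "H_convex \<phi>" and s: "\<bar>s\<bar> \<le> r"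
  shows "\<phi> (a \<odot> hexp (s *\<^sub>R v)) \<le> max (\<phi> (a \<odot> hexp (r *\<^sub>R v))) (\<phi> (a \<odot> hexp (- r *\<^sub>R v)))"
proof (cases "r = 0")
  case True
  then show ?thesis using s by simp
next
  case False
  with s have r: "r > 0" by linarith
  \<comment> \<open>The relative position of \<open>s\<close> in the interval from
    \<open>- r\<close> to \<open>r\<close>.\<close>
  define l where "l = (s + r) / (2 * r)"
  have l: "0 \<le> l" "l \<le> 1" and sl: "- r + l * (2 * r) = s" "- r + 2 * r = r"
    using s r by (auto simp: l_def divide_simps)
  let ?b = "a \<odot> hexp (- r *\<^sub>R v)"
  have e: "?b \<odot> hexp (l *\<^sub>R ((2 * r) *\<^sub>R v)) = a \<odot> hexp (s *\<^sub>R v)"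
      "?b \<odot> hexp ((2 * r) *\<^sub>R v) = a \<odot> hexp (r *\<^sub>R v)"
    unfolding scaleR_scaleR hmult_hexp_hexp_scaled sl by simp_all
  have "\<phi> (a \<odot> hexp (s *\<^sub>R v)) \<le> (1 - l) * \<phi> ?b + l * \<phi> (a \<odot> hexp (r *\<^sub>R v))"
    using H_convexD[OF H l, of ?b "(2 * r) *\<^sub>R v"] by (simp only: e)
  also have "\<dots> \<le> max (\<phi> (a \<odot> hexp (r *\<^sub>R v))) (\<phi> ?b)"
    using l by (intro convex_bound_le) auto
  finally show ?thesis .
qed

lemma H_convex_midpoint:
  assumes "H_convex \<phi>"
  shows "2 * \<phi> a \<le> \<phi> (a \<odot> hexp h) + \<phi> (a \<odot> hexp (- h))"
proof -
  have e: "a \<odot> hexp (- h) \<odot> hexp ((1/2) *\<^sub>R (2 *\<^sub>R h)) = a"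
    by simp
  have e2: "a \<odot> hexp (- h) \<odot> hexp (2 *\<^sub>R h) = a \<odot> hexp h"
    using hmult_hexp_hexp_scaled[of a "-1" h 2] by simp
  show ?thesis
    using H_convexD[OF assms, of "1/2" "a \<odot> hexp (- h)" "2 *\<^sub>R h"] unfolding e e2 by simp
qed

subsection \<open>Local boundedness\<close>

text \<open>The point \<open>(0, 0, t)\<close> is the midpoint of two points that move, as \<open>t\<close> varies, along two fixed
  horizontal lines.\<close>

lemma H_convex_bounded_vert:
  assumes H: "H_convex (\<phi> :: 'n::finite heis \<Rightarrow> real)"
  shows "\<exists>M. \<forall>t. \<bar>t\<bar> \<le> T \<longrightarrow> \<phi> (vert t) \<le> M"
proof -
  obtain e :: "real ^ 'n" where "e \<in> Basis" using nonempty_Basis by blast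
  then have e: "e \<bullet> e = 1" by simp
  \<comment> \<open>The factor 1/2 offsets the factor 2 of the group law: the twist of
    \<open>u\<close> against \<open>- t\<close> times \<open>v\<close> is then exactly
    \<open>t\<close>.\<close>
  define u v :: "'n hvec" where "u = ((1/2) *\<^sub>R e, 0)" and "v = (0, e)"
  let ?f = "\<lambda>b r. \<phi> (hexp b \<odot> hexp (r *\<^sub>R v))"
  have "\<phi> (vert t) \<le> (max (?f u T) (?f u (- T)) + max (?f (- u) T) (?f (- u) (- T))) / 2"
    if t: "\<bar>t\<bar> \<le> T" for t
  proof -
    have a: "vert t \<odot> hexp (u - t *\<^sub>R v) = hexp u \<odot> hexp ((- t) *\<^sub>R v)"
        "vert t \<odot> hexp (- (u - t *\<^sub>R v)) = hexp (- u) \<odot> hexp (t *\<^sub>R v)"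
      by (simp_all add: hexp_def vert_def u_def v_def e)
    have "2 * \<phi> (vert t) \<le> ?f u (- t) + ?f (- u) t"
      using H_convex_midpoint[OF H, of "vert t" "u - t *\<^sub>R v"] by (simp only: a)
    moreover have "?f u (- t) \<le> max (?f u T) (?f u (- T))" "?f (- u) t \<le> max (?f (- u) T) (?f (- u) (- T))"
      using t by (intro H_convex_le_max[OF H]; simp)+
    ultimately show ?thesis by simp
  qed
  then show ?thesis by blast
qed

text \<open>For a fixed horizontal point the bound over \<open>t\<close> comes from left
  translation. As \<open>vert t\<close> is central, \<open>s\<close> moves along a horizontal line
  through it, where the two ends dominate.\<close>

lemma H_convex_bounded_hexp_vert:
  assumes H: "H_convex \<phi>"
  shows "\<exists>M. \<forall>s t. \<bar>s\<bar> \<le> r \<longrightarrow> \<bar>t\<bar> \<le> T \<longrightarrow> \<phi> (hexp (s *\<^sub>R v) \<odot> vert t) \<le> M"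
proof -
  have "\<exists>M. \<forall>t. \<bar>t\<bar> \<le> T \<longrightarrow> \<phi> (hexp w \<odot> vert t) \<le> M" for w
    using H_convex_bounded_vert[OF H_convex_left_translate[OF H]] .
  then obtain M where M: "\<And>w t. \<bar>t\<bar> \<le> T \<Longrightarrow> \<phi> (hexp w \<odot> vert t) \<le> M w" by metis
  have "\<phi> (hexp (s *\<^sub>R v) \<odot> vert t) \<le> max (M (r *\<^sub>R v)) (M (- r *\<^sub>R v))"
    if "\<bar>s\<bar> \<le> r" "\<bar>t\<bar> \<le> T" for s t
    using H_convex_le_max[OF H that(1), of "vert t" v] M[OF that(2), of "r *\<^sub>R v"]
      M[OF that(2), of "- r *\<^sub>R v"] unfolding vert_commute by linarith
  then show ?thesis by blast
qed

text \<open>Commutators are vertical; exchanging the factors flips the sign of the twist, hence 4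
  instead of 2.\<close>

lemma hexp_hmult_commute:
  "hexp v \<odot> b = b \<odot> (hexp v \<odot> vert (4 * (fst b \<bullet> snd v - fst v \<bullet> fst (snd b))))"
  by (cases b) (simp add: hexp_def vert_def inner_commute)

text \<open>Commuting \<open>hexp\<close> past \<open>b\<close> turns the left multiplication into a
  right one, at the cost of a vertical shift linear in \<open>s\<close> and hence bounded. This
  makes the supremum over \<open>s\<close> finite.\<close>

lemma H_convex_bounded_hexp_hmult:
  assumes H: "H_convex \<phi>"
  shows "\<exists>M. \<forall>s. \<bar>s\<bar> \<le> r \<longrightarrow> \<phi> (hexp (s *\<^sub>R v) \<odot> b) \<le> M"
proof -
  define c where "c = 4 * (fst b \<bullet> snd v - fst v \<bullet> fst (snd b))"
  obtain M where M: "\<And>s t. \<bar>s\<bar> \<le> r \<Longrightarrow> \<bar>t\<bar> \<le> r * \<bar>c\<bar> \<Longrightarrow> \<phi> (b \<odot> (hexp (s *\<^sub>R v) \<odot> vert t)) \<le> M"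
    using H_convex_bounded_hexp_vert[OF H_convex_left_translate[OF H]] by metis
  have "\<phi> (hexp (s *\<^sub>R v) \<odot> b) \<le> M" if "\<bar>s\<bar> \<le> r" for s
  proof -
    have "hexp (s *\<^sub>R v) \<odot> b = b \<odot> (hexp (s *\<^sub>R v) \<odot> vert (s * c))"
      by (subst hexp_hmult_commute) (simp add: c_def algebra_simps)
    moreover have "\<bar>s * c\<bar> \<le> r * \<bar>c\<bar>" using that by (simp add: abs_mult mult_right_mono)
    ultimately show ?thesis using M[OF that] by simp
  qed
  then show ?thesis by blast
qed

text \<open>A finite supremum of left translates of an H-convex function is H-convex. Bounding
  \<open>\<psi>\<close> instead of \<open>\<phi>\<close> disposes of the direction
  \<open>v\<close>.\<close>

lemma H_convex_SUP_hexp_hmult: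
  fixes \<phi> :: "'n::finite heis \<Rightarrow> real" and v :: "'n hvec"
  assumes H: "H_convex \<phi>" and r: "0 \<le> r"
  defines "\<psi> \<equiv> \<lambda>b. SUP s\<in>{-r..r}. \<phi> (hexp (s *\<^sub>R v) \<odot> b)"
  shows "H_convex \<psi>" and "\<And>s b. \<bar>s\<bar> \<le> r \<Longrightarrow> \<phi> (hexp (s *\<^sub>R v) \<odot> b) \<le> \<psi> b"
proof -
  have bdd: "bdd_above ((\<lambda>s. \<phi> (hexp (s *\<^sub>R v) \<odot> b)) ` {-r..r})" for b
  proof -
    obtain M where "\<And>s. \<bar>s\<bar> \<le> r \<Longrightarrow> \<phi> (hexp (s *\<^sub>R v) \<odot> b) \<le> M"
      using H_convex_bounded_hexp_hmult[OF H] by metis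
    then show ?thesis by (intro bdd_aboveI2[where M = M]) (auto simp: abs_le_iff)
  qed
  show up: "\<phi> (hexp (s *\<^sub>R v) \<odot> b) \<le> \<psi> b" if "\<bar>s\<bar> \<le> r" for s b
    unfolding \<psi>_def using that by (intro cSUP_upper[OF _ bdd]) auto
  show "H_convex \<psi>"
    unfolding H_convex_iff
  proof (intro allI impI)
    fix a h and l :: real assume l: "0 \<le> l" "l \<le> 1"
    show "\<psi> (a \<odot> hexp (l *\<^sub>R h)) \<le> (1 - l) * \<psi> a + l * \<psi> (a \<odot> hexp h)"
      \<comment> \<open>Only the value on the left is expanded into a supremum; the right side keeps
        \<open>\<psi>\<close> as its bound.\<close>
      unfolding \<psi>_def[THEN meta_eq_to_obj_eq, THEN fun_cong, of "a \<odot> hexp (l *\<^sub>R h)"]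
    proof (rule cSUP_least)
      show "{-r..r} \<noteq> {}" using r by simp
      fix s assume "s \<in> {-r..r}"
      then have s: "\<bar>s\<bar> \<le> r" by auto
      have "\<phi> (hexp (s *\<^sub>R v) \<odot> (a \<odot> hexp (l *\<^sub>R h)))
          \<le> (1 - l) * \<phi> (hexp (s *\<^sub>R v) \<odot> a) + l * \<phi> (hexp (s *\<^sub>R v) \<odot> (a \<odot> hexp h))"
        using H_convexD[OF H l] by (simp only: hmult_assoc[symmetric])
      also have "\<dots> \<le> (1 - l) * \<psi> a + l * \<psi> (a \<odot> hexp h)"
        using up[OF s] l by (intro add_mono mult_left_mono) auto
      finally show "\<phi> (hexp (s *\<^sub>R v) \<odot> (a \<odot> hexp (l *\<^sub>R h))) \<le> (1 - l) * \<psi> a + l * \<psi> (a \<odot> hexp h)" .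
    qed
  qed
qed

lemma hexp_add_vert:
  "hexp (v + w) \<odot> vert t = hexp v \<odot> (hexp w \<odot> vert (t - 2 * (fst w \<bullet> snd v - fst v \<bullet> snd w)))"
  by (simp add: hexp_def vert_def)

lemma symplectic_bound:
  fixes v w :: "'n::finite hvec"
  shows "\<bar>fst w \<bullet> snd v - fst v \<bullet> snd w\<bar> \<le> 2 * (norm v * norm w)"
proof -
  have n: "norm (fst z) \<le> norm z" "norm (snd z) \<le> norm z" for z :: "'n hvec"
    by (metis norm_fst_le norm_snd_le prod.collapse)+
  have "\<bar>fst z \<bullet> snd z'\<bar> \<le> norm z * norm z'" for z z' :: "'n hvec"
    by (rule order_trans[OF Cauchy_Schwarz_ineq2]) (intro mult_mono n norm_ge_zero)
  from this[of w v] this[of v w] show ?thesis by (simp add: mult.commute)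
qed

text \<open>Induction over the directions: the summand for \<open>b0\<close> is split off on the
  left and absorbed by \<open>\<psi>\<close>. The split shifts the height, so the induction
  hypothesis is needed for other functions and larger \<open>T\<close>.\<close>

lemma H_convex_bounded_box:
  fixes \<phi> :: "'n::finite heis \<Rightarrow> real"
  assumes "finite F" "F \<subseteq> Basis" "H_convex \<phi>" "0 \<le> R"
  shows "\<exists>M. \<forall>c t. (\<forall>b\<in>F. \<bar>c b\<bar> \<le> R) \<longrightarrow> \<bar>t\<bar> \<le> T \<longrightarrow> \<phi> (hexp (\<Sum>b\<in>F. c b *\<^sub>R b) \<odot> vert t) \<le> M"
  using assms(1-3)
proof (induction F arbitrary: \<phi> T rule: finite_induct)
  case empty
  then show ?case using H_convex_bounded_vert by (simp add: hmult_he)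
next
  case (insert b0 F)
  define \<psi> where "\<psi> b = (SUP s\<in>{-R..R}. \<phi> (hexp (s *\<^sub>R b0) \<odot> b))" for b
  note \<psi> = H_convex_SUP_hexp_hmult[OF insert.prems(2) \<open>0 \<le> R\<close>, where v = b0, folded \<psi>_def]
  \<comment> \<open>The shift is twice the symplectic product of the split summand and the remaining
    sum, whose norms are at most \<open>R\<close> and \<open>card F * R\<close>.\<close>
  define T' where "T' = T + 4 * (R * (card F * R))"
  obtain M where M: "\<And>c t. (\<forall>b\<in>F. \<bar>c b\<bar> \<le> R) \<Longrightarrow> \<bar>t\<bar> \<le> T' \<Longrightarrow>
      \<psi> (hexp (\<Sum>b\<in>F. c b *\<^sub>R b) \<odot> vert t) \<le> M"
    using insert.IH[OF _ \<psi>(1), of T'] insert.prems by blast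
  have "\<phi> (hexp (\<Sum>b\<in>insert b0 F. c b *\<^sub>R b) \<odot> vert t) \<le> M"
    if c: "\<forall>b\<in>insert b0 F. \<bar>c b\<bar> \<le> R" and t: "\<bar>t\<bar> \<le> T" for c t
  proof -
    let ?v = "c b0 *\<^sub>R b0"
    let ?w = "\<Sum>b\<in>F. c b *\<^sub>R b"
    let ?t = "t - 2 * (fst ?w \<bullet> snd ?v - fst ?v \<bullet> snd ?w)"
    have nv: "norm ?v \<le> R" using c insert.prems(1) by simp
    have "norm ?w \<le> (\<Sum>b\<in>F. R)"
      using c insert.prems(1) by (intro sum_norm_le) auto
    then have nw: "norm ?w \<le> card F * R" by simp
    have aux: "\<bar>t - 2 * x\<bar> \<le> T + 4 * z" if "\<bar>x\<bar> \<le> 2 * y" "y \<le> z" for x y z :: real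
      using that t by linarith
    have "norm ?v * norm ?w \<le> R * (card F * R)"
      using nv nw by (intro mult_mono) (auto simp: \<open>0 \<le> R\<close>)
    then have "\<bar>?t\<bar> \<le> T'"
      unfolding T'_def by (rule aux[OF symplectic_bound])
    then have "\<psi> (hexp ?w \<odot> vert ?t) \<le> M" using M c by simp
    moreover have "\<phi> (hexp ?v \<odot> (hexp ?w \<odot> vert ?t)) \<le> \<psi> (hexp ?w \<odot> vert ?t)"
      using \<psi>(2) c by simp
    ultimately show ?thesis
      using insert.hyps by (simp add: hexp_add_vert)
  qed
  then show ?case by blast
qed

lemma H_convex_bounded_above:
  fixes \<phi> :: "'n::finite heis \<Rightarrow> real"
  assumes H: "H_convex \<phi>" and A: "bounded A"
  shows "\<exists>M. \<forall>\<xi>\<in>A. \<phi> \<xi> \<le> M"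
proof -
  obtain R where R: "R > 0" "\<And>\<xi>. \<xi> \<in> A \<Longrightarrow> norm \<xi> \<le> R"
    using A by (auto simp: bounded_pos)
  obtain M where M: "\<And>c t. (\<forall>b\<in>Basis. \<bar>c b\<bar> \<le> R) \<Longrightarrow> \<bar>t\<bar> \<le> R \<Longrightarrow>
      \<phi> (hexp (\<Sum>b\<in>Basis. c b *\<^sub>R b) \<odot> vert t) \<le> M"
    using H_convex_bounded_box[of Basis, OF finite_Basis order_refl H, of R R] R(1) by auto
  have "\<phi> \<xi> \<le> M" if "\<xi> \<in> A" for \<xi>
  proof -
    obtain x y t where xi: "\<xi> = (x, y, t)" by (cases \<xi>)
    have n: "norm (x, y) \<le> R" "\<bar>t\<bar> \<le> R"
    proof -
      have "norm (x, y) \<le> norm \<xi>"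
        by (simp add: xi norm_Pair)
      then show "norm (x, y) \<le> R" using R(2)[OF that] by linarith
      have "\<bar>t\<bar> \<le> norm (y, t)" using norm_snd_le[of t y] by simp
      also have "\<dots> \<le> norm \<xi>" using norm_snd_le[of "(y, t)" x] by (simp add: xi)
      finally show "\<bar>t\<bar> \<le> R" using R(2)[OF that] by linarith
    qed
    have "\<bar>(x, y) \<bullet> b\<bar> \<le> R" if "b \<in> Basis" for b
      using Basis_le_norm[OF that, of "(x, y)"] n(1) by linarith
    then have "\<phi> (hexp (x, y) \<odot> vert t) \<le> M"
      using M[of "\<lambda>b. (x, y) \<bullet> b" t] n(2) by (simp only: euclidean_representation) blast
    then show ?thesis by (simp add: xi hexp_def vert_def)
  qed
  then show ?thesis by blast
qed

section \<open>Horizontal moves and bounds from below\<close>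

text \<open>The points reached from \<open>A\<close> by one horizontal move of length at most
  \<open>r\<close>; four iterations reach every direction, including the vertical one.\<close>

definition hnbhd :: "'n::finite heis set \<Rightarrow> real \<Rightarrow> 'n heis set" where
  "hnbhd A r = (\<lambda>(a, h). a \<odot> hexp h) ` (A \<times> cball 0 r)"

lemma hnbhdI: "a \<in> A \<Longrightarrow> norm h \<le> r \<Longrightarrow> a \<odot> hexp h \<in> hnbhd A r"
  by (force simp: hnbhd_def)

lemma continuous_on_hmult_hexp: "continuous_on X (\<lambda>(a, h). a \<odot> hexp h)"
  unfolding hmult_hexp_eq case_prod_unfold by (intro continuous_intros)

text \<open>For the closure of \<open>A\<close> this is the continuous image of a compact
  product.\<close>

lemma bounded_hnbhd:
  fixes A :: "'n::finite heis set"
  assumes "bounded A"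
  shows "bounded (hnbhd A r)"
proof -
  have "compact (closure A \<times> cball (0 :: 'n hvec) r)"
    using assms by (simp add: compact_Times)
  then have "bounded (hnbhd (closure A) r)"
    unfolding hnbhd_def
    by (intro compact_imp_bounded compact_continuous_image[OF continuous_on_hmult_hexp])
  moreover have "hnbhd A r \<subseteq> hnbhd (closure A) r"
    unfolding hnbhd_def by (intro image_mono Sigma_mono closure_subset order_refl)
  ultimately show ?thesis by (rule bounded_subset)
qed

text \<open>The vertical part is a horizontal triangle with symplectic area proportional to \<open>t\<close>.\<close>

lemma horizontal_decomposition:
  fixes \<zeta> :: "'n::finite heis"
  obtains h1 h2 h3 h4 where
    "\<zeta> = hexp h1 \<odot> hexp h2 \<odot> hexp h3 \<odot> hexp h4" "Pr1 \<zeta> = h1 + h2 + h3 + h4"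
    "norm h1 \<le> 2 * gauge_norm \<zeta>" "norm h2 \<le> 2 * gauge_norm \<zeta>"
    "norm h3 \<le> 2 * gauge_norm \<zeta>" "norm h4 \<le> 2 * gauge_norm \<zeta>"
proof -
  obtain x y t where z: "\<zeta> = (x, y, t)" by (cases \<zeta>)
  obtain e :: "real ^ 'n" where "e \<in> Basis" using nonempty_Basis by blast
  then have e: "e \<bullet> e = 1" "norm e = 1" by simp_all
  \<comment> \<open>The moves \<open>u\<close>, \<open>v\<close>, \<open>- (u + v)\<close> below
    close up horizontally and end at height \<open>- 2 * (a * b)\<close>; \<open>a\<close> and
    \<open>b\<close> make this equal to \<open>t\<close>, with both sizes of order the square root
    of the height.\<close>
  define a where "a = sqrt (\<bar>t\<bar> / 2)"
  define b where "b = - sgn t * a"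
  have "a * b = - sgn t * (a * a)" by (simp add: b_def)
  also have "a * a = \<bar>t\<bar> / 2" by (simp add: a_def)
  finally have ab: "- 2 * (a * b) = t" using sgn_mult_abs[of t] by simp
  let ?g = "gauge_norm \<zeta>"
  have g4: "?g ^ 4 = ((norm x)\<^sup>2 + (norm y)\<^sup>2)\<^sup>2 + t\<^sup>2" and g0: "?g \<ge> 0"
    by (simp_all add: z)
  \<comment> \<open>The rule compares powers with exponent \<open>Suc n\<close>, so
    \<open>n = 3\<close> means fourth powers, where the gauge norm has no root.\<close>
  have g1: "norm (x, y) \<le> ?g"
  proof (rule power_le_imp_le_base[where n = 3])
    have "norm (x, y) ^ 4 = ((norm x)\<^sup>2 + (norm y)\<^sup>2)\<^sup>2"
    proof -
      have "norm (x, y) ^ 4 = ((norm (x, y))\<^sup>2)\<^sup>2" by simp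
      then show ?thesis by (simp add: norm_Pair)
    qed
    then show "norm (x, y) ^ Suc 3 \<le> ?g ^ Suc 3" using g4 by (simp add: numeral_eq_Suc)
  qed (fact g0)
  have g2: "a \<le> ?g"
  proof (rule power_le_imp_le_base[where n = 3])
    have "a ^ 4 = (a\<^sup>2)\<^sup>2" by simp
    also have "\<dots> = t\<^sup>2 / 4" by (simp add: a_def power_divide)
    also have "\<dots> \<le> ?g ^ 4"
      unfolding g4 using zero_le_power2[of t] zero_le_power2[of "(norm x)\<^sup>2 + (norm y)\<^sup>2"] by linarith
    finally show "a ^ Suc 3 \<le> ?g ^ Suc 3" by (simp add: numeral_eq_Suc)
  qed (fact g0)
  have a0: "0 \<le> a" "\<bar>b\<bar> \<le> a" by (auto simp: a_def b_def abs_mult abs_sgn_eq)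
  define u v :: "'n hvec" where "u = (a *\<^sub>R e, 0)" and "v = (0, b *\<^sub>R e)"
  have u: "norm u = a" and v: "norm v = \<bar>b\<bar>"
    using a0 by (simp_all add: u_def v_def norm_Pair e)
  show thesis
  proof (rule that[of "(x, y)" u v "- (u + v)"])
    show "\<zeta> = hexp (x, y) \<odot> hexp u \<odot> hexp v \<odot> hexp (- (u + v))"
      using ab by (simp add: z hexp_def u_def v_def e inner_commute algebra_simps)
    show "norm (- (u + v)) \<le> 2 * ?g"
      using norm_triangle_ineq[of u v] u v a0 g2 unfolding norm_minus_cancel by linarith
    show "norm (x, y) \<le> 2 * ?g" "norm u \<le> 2 * ?g" "norm v \<le> 2 * ?g"
      using g0 g1 g2 a0 u v by linarith+
    show "Pr1 \<zeta> = (x, y) + u + v + - (u + v)" by (simp add: z)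
  qed
qed

lemma gauge_norm_eq:
  "gauge_norm \<zeta> = root 4 (((norm (fst \<zeta>))\<^sup>2 + (norm (fst (snd \<zeta>)))\<^sup>2)\<^sup>2 + (snd (snd \<zeta>))\<^sup>2)"
  by (cases \<zeta>) simp

lemma gauge_norm_nonneg [simp]: "gauge_norm \<zeta> \<ge> 0"
  by (cases \<zeta>) simp

lemma gauge_norm_he [simp]: "gauge_norm he = 0"
  by (simp add: he_def)

lemma tendsto_gauge_norm: "((\<lambda>\<zeta>. gauge_norm (hinv \<xi> \<odot> \<zeta>)) \<longlongrightarrow> 0) (at \<xi>)"
proof -
  have "isCont (\<lambda>\<zeta>. gauge_norm (hinv \<xi> \<odot> \<zeta>)) \<xi>"
    unfolding gauge_norm_eq hmult_eq fst_conv snd_conv by (intro continuous_intros)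
  then show ?thesis by (simp add: isCont_def hmult_hinv)
qed

text \<open>In the midpoint inequality at \<open>a\<close>, an upper bound at the reflected point
  and a lower bound at \<open>a\<close> leave a lower bound at the point itself.\<close>

lemma H_convex_bounded_below_hnbhd:
  assumes H: "H_convex \<phi>" and A: "bounded A" and m: "\<exists>m. \<forall>\<xi>\<in>A. m \<le> \<phi> \<xi>"
  shows "\<exists>m. \<forall>\<xi>\<in>hnbhd A r. m \<le> \<phi> \<xi>"
proof -
  obtain M where M: "\<And>\<xi>. \<xi> \<in> hnbhd A r \<Longrightarrow> \<phi> \<xi> \<le> M"
    using H_convex_bounded_above[OF H bounded_hnbhd[OF A]] by metis
  obtain m where m: "\<And>\<xi>. \<xi> \<in> A \<Longrightarrow> m \<le> \<phi> \<xi>" using m by blast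
  have "2 * m - M \<le> \<phi> \<xi>" if "\<xi> \<in> hnbhd A r" for \<xi>
  proof -
    obtain a h where ah: "a \<in> A" "norm h \<le> r" "\<xi> = a \<odot> hexp h"
      using \<open>\<xi> \<in> hnbhd A r\<close> by (auto simp: hnbhd_def)
    have "\<phi> (a \<odot> hexp (- h)) \<le> M" using ah by (intro M hnbhdI) auto
    then show ?thesis
      using H_convex_midpoint[OF H, of a h] m[OF ah(1)] unfolding ah(3) by linarith
  qed
  then show ?thesis by blast
qed

text \<open>Four horizontal moves from the single point \<open>he\<close> cover \<open>A\<close>,
  and each move preserves lower bounds.\<close>

lemma H_convex_bounded_below:
  assumes H: "H_convex \<phi>" and A: "bounded A"
  shows "\<exists>m. \<forall>\<xi>\<in>A. m \<le> \<phi> \<xi>"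
proof -
  have "compact (gauge_norm ` closure A)"
    by (rule compact_continuous_image) (auto simp: gauge_norm_eq[abs_def] A intro!: continuous_intros)
  then obtain r where r: "\<And>\<xi>. \<xi> \<in> A \<Longrightarrow> gauge_norm \<xi> \<le> r"
    using closure_subset[of A] by (fastforce dest!: compact_imp_bounded simp: bounded_iff)
  let ?N = "\<lambda>B. hnbhd B (2 * r)"
  have "A \<subseteq> ?N (?N (?N (?N {he})))"
  proof
    fix \<xi> assume "\<xi> \<in> A"
    then have g: "2 * gauge_norm \<xi> \<le> 2 * r" using r by simp
    obtain h1 h2 h3 h4 where h:
      "\<xi> = hexp h1 \<odot> hexp h2 \<odot> hexp h3 \<odot> hexp h4"
      "norm h1 \<le> 2 * gauge_norm \<xi>" "norm h2 \<le> 2 * gauge_norm \<xi>"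
      "norm h3 \<le> 2 * gauge_norm \<xi>" "norm h4 \<le> 2 * gauge_norm \<xi>"
      by (rule horizontal_decomposition)
    have "he \<odot> hexp h1 \<odot> hexp h2 \<odot> hexp h3 \<odot> hexp h4 \<in> ?N (?N (?N (?N {he})))"
      using h(2-) g by (intro hnbhdI) auto
    then show "\<xi> \<in> ?N (?N (?N (?N {he})))" by (simp add: hmult_he h(1))
  qed
  moreover have "\<exists>m. \<forall>\<xi>\<in>?N (?N (?N (?N {he}))). m \<le> \<phi> \<xi>"
    by (intro H_convex_bounded_below_hnbhd[OF H] bounded_hnbhd) auto
  ultimately show ?thesis by blast
qed

subsection \<open>Horizontal Lipschitz estimates and continuity\<close>

text \<open>By convexity the slope towards \<open>h\<close> is at most the slope over unit length in
  the direction \<open>sgn h\<close>, which the bounds on \<open>\<phi>\<close> control.\<close>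

lemma H_convex_increment_le:
  assumes H: "H_convex \<phi>" and A: "bounded A"
  shows "\<exists>L\<ge>0. \<forall>\<xi>\<in>A. \<forall>h. norm h \<le> 1 \<longrightarrow> \<phi> (\<xi> \<odot> hexp h) - \<phi> \<xi> \<le> L * norm h"
proof -
  obtain M where M: "\<And>\<xi>. \<xi> \<in> hnbhd A 1 \<Longrightarrow> \<phi> \<xi> \<le> M"
    using H_convex_bounded_above[OF H bounded_hnbhd[OF A]] by metis
  obtain m where m: "\<And>\<xi>. \<xi> \<in> A \<Longrightarrow> m \<le> \<phi> \<xi>"
    using H_convex_bounded_below[OF H A] by blast
  have "\<phi> (\<xi> \<odot> hexp h) - \<phi> \<xi> \<le> \<bar>M - m\<bar> * norm h" if \<xi>: "\<xi> \<in> A" and h: "norm h \<le> 1" for \<xi> h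
  proof -
    have sg: "norm h *\<^sub>R sgn h = h" by (cases "h = 0") (simp_all add: sgn_div_norm)
    have "\<phi> (\<xi> \<odot> hexp h) \<le> (1 - norm h) * \<phi> \<xi> + norm h * \<phi> (\<xi> \<odot> hexp (sgn h))"
      using H_convexD[OF H norm_ge_zero h, of \<xi> "sgn h"] by (simp only: sg)
    then have "\<phi> (\<xi> \<odot> hexp h) - \<phi> \<xi> \<le> norm h * (\<phi> (\<xi> \<odot> hexp (sgn h)) - \<phi> \<xi>)"
      by (simp add: algebra_simps)
    also have "\<dots> \<le> norm h * \<bar>M - m\<bar>"
    proof (intro mult_left_mono norm_ge_zero)
      have "\<phi> (\<xi> \<odot> hexp (sgn h)) \<le> M"
        using \<xi> by (intro M hnbhdI) (auto simp: norm_sgn)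
      then show "\<phi> (\<xi> \<odot> hexp (sgn h)) - \<phi> \<xi> \<le> \<bar>M - m\<bar>" using m[OF \<xi>] by linarith
    qed
    finally show ?thesis by (simp add: mult.commute)
  qed
  then show ?thesis by (intro exI[of _ "\<bar>M - m\<bar>"]) auto
qed

text \<open>The lower estimate is the upper one for the move back, which starts in
  \<open>hnbhd A 1\<close>.\<close>

lemma H_convex_horizontal_Lipschitz:
  assumes H: "H_convex \<phi>" and A: "bounded A"
  shows "\<exists>L\<ge>0. \<forall>\<xi>\<in>A. \<forall>h. norm h \<le> 1 \<longrightarrow> \<bar>\<phi> (\<xi> \<odot> hexp h) - \<phi> \<xi>\<bar> \<le> L * norm h"
proof -
  obtain L where L: "L \<ge> 0" "\<And>\<xi> h. \<xi> \<in> A \<union> hnbhd A 1 \<Longrightarrow> norm h \<le> 1 \<Longrightarrow> \<phi> (\<xi> \<odot> hexp h) - \<phi> \<xi> \<le> L * norm h"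
    using H_convex_increment_le[OF H, of "A \<union> hnbhd A 1"] A bounded_hnbhd[OF A] by auto
  have "\<bar>\<phi> (\<xi> \<odot> hexp h) - \<phi> \<xi>\<bar> \<le> L * norm h" if "\<xi> \<in> A" "norm h \<le> 1" for \<xi> h
    using L(2)[of \<xi> h] L(2)[of "\<xi> \<odot> hexp h" "- h"] hnbhdI[of \<xi> A h 1] that by simp
  then show ?thesis using L(1) by blast
qed

lemma H_convex_isCont:
  assumes H: "H_convex \<phi>"
  shows "isCont \<phi> \<xi>"
proof -
  let ?N = "\<lambda>B. hnbhd B 1"
  \<comment> \<open>Contains the starting points of four successive moves of length at most
    1.\<close>
  define A where "A = {\<xi>} \<union> ?N {\<xi>} \<union> ?N (?N {\<xi>}) \<union> ?N (?N (?N {\<xi>}))"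
  have "bounded A" by (simp add: A_def bounded_hnbhd)
  then obtain L where L: "L \<ge> 0" "\<And>a h. a \<in> A \<Longrightarrow> norm h \<le> 1 \<Longrightarrow> \<bar>\<phi> (a \<odot> hexp h) - \<phi> a\<bar> \<le> L * norm h"
    using H_convex_horizontal_Lipschitz[OF H] by metis
  \<comment> \<open>Four moves of length at most twice the gauge norm give the factor 8; the bound
    1/2 keeps each length at most 1.\<close>
  have *: "\<bar>\<phi> \<zeta> - \<phi> \<xi>\<bar> \<le> 8 * L * gauge_norm (hinv \<xi> \<odot> \<zeta>)" if "gauge_norm (hinv \<xi> \<odot> \<zeta>) < 1/2" for \<zeta>
  proof -
    let ?g = "gauge_norm (hinv \<xi> \<odot> \<zeta>)"
    obtain h1 h2 h3 h4 where h:
      "hinv \<xi> \<odot> \<zeta> = hexp h1 \<odot> hexp h2 \<odot> hexp h3 \<odot> hexp h4"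
      "norm h1 \<le> 2 * ?g" "norm h2 \<le> 2 * ?g" "norm h3 \<le> 2 * ?g" "norm h4 \<le> 2 * ?g"
      by (rule horizontal_decomposition)
    define a1 a2 a3 where "a1 = \<xi> \<odot> hexp h1" and "a2 = a1 \<odot> hexp h2" and "a3 = a2 \<odot> hexp h3"
    have \<zeta>: "\<zeta> = a3 \<odot> hexp h4"
      using arg_cong[OF h(1), of "\<lambda>z. \<xi> \<odot> z"] by (simp add: a1_def a2_def a3_def hmult_assoc)
    have n: "norm h1 \<le> 1" "norm h2 \<le> 1" "norm h3 \<le> 1" "norm h4 \<le> 1" using h that by linarith+
    have "a1 \<in> ?N {\<xi>}" unfolding a1_def using n by (intro hnbhdI) auto
    moreover from this have "a2 \<in> ?N (?N {\<xi>})" unfolding a2_def using n by (intro hnbhdI) auto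
    moreover from this have "a3 \<in> ?N (?N (?N {\<xi>}))" unfolding a3_def using n by (intro hnbhdI) auto
    ultimately have a: "\<xi> \<in> A" "a1 \<in> A" "a2 \<in> A" "a3 \<in> A" by (auto simp: A_def)
    have b: "L * norm k \<le> L * (2 * ?g)" if "norm k \<le> 2 * ?g" for k :: "'a hvec"
      using that L(1) by (rule mult_left_mono)
    have "\<bar>\<phi> a1 - \<phi> \<xi>\<bar> \<le> L * (2 * ?g)" "\<bar>\<phi> a2 - \<phi> a1\<bar> \<le> L * (2 * ?g)"
      "\<bar>\<phi> a3 - \<phi> a2\<bar> \<le> L * (2 * ?g)" "\<bar>\<phi> \<zeta> - \<phi> a3\<bar> \<le> L * (2 * ?g)"
      using L(2)[OF a(1) n(1)] L(2)[OF a(2) n(2)] L(2)[OF a(3) n(3)] L(2)[OF a(4) n(4)]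
        b[OF h(2)] b[OF h(3)] b[OF h(4)] b[OF h(5)]
      by (simp_all add: a1_def[symmetric] a2_def[symmetric] a3_def[symmetric] \<zeta>[symmetric])
    then show ?thesis by (simp add: algebra_simps)
  qed
  have "((\<lambda>\<zeta>. \<phi> \<zeta> - \<phi> \<xi>) \<longlongrightarrow> 0) (at \<xi>)"
  proof (rule Lim_null_comparison)
    have "\<forall>\<^sub>F \<zeta> in at \<xi>. gauge_norm (hinv \<xi> \<odot> \<zeta>) < 1/2"
      by (rule order_tendstoD(2)[OF tendsto_gauge_norm]) simp
    then show "\<forall>\<^sub>F \<zeta> in at \<xi>. norm (\<phi> \<zeta> - \<phi> \<xi>) \<le> 8 * L * gauge_norm (hinv \<xi> \<odot> \<zeta>)"
      by eventually_elim (use * in simp)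
    show "((\<lambda>\<zeta>. 8 * L * gauge_norm (hinv \<xi> \<odot> \<zeta>)) \<longlongrightarrow> 0) (at \<xi>)"
      by (rule tendsto_mult_right_zero[OF tendsto_gauge_norm])
  qed
  then show ?thesis by (simp add: isCont_def LIM_zero_iff)
qed

subsection \<open>The horizontal subdifferential\<close>

lemma H_subdiff_iff: "p \<in> H_subdiff \<phi> \<xi> \<longleftrightarrow> (\<forall>h. \<phi> \<xi> + p \<bullet> h \<le> \<phi> (\<xi> \<odot> hexp h))"
proof
  assume p: "p \<in> H_subdiff \<phi> \<xi>"
  show "\<forall>h. \<phi> \<xi> + p \<bullet> h \<le> \<phi> (\<xi> \<odot> hexp h)"
  proof
    fix h
    have "\<phi> (\<xi> \<odot> hexp h) \<ge> \<phi> \<xi> + p \<bullet> (Pr1 (\<xi> \<odot> hexp h) - Pr1 \<xi>)"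
      using p hmult_hexp_in_hplane unfolding H_subdiff_def by blast
    then show "\<phi> \<xi> + p \<bullet> h \<le> \<phi> (\<xi> \<odot> hexp h)" by simp
  qed
next
  assume R: "\<forall>h. \<phi> \<xi> + p \<bullet> h \<le> \<phi> (\<xi> \<odot> hexp h)"
  show "p \<in> H_subdiff \<phi> \<xi>"
    unfolding H_subdiff_def mem_Collect_eq
  proof
    fix \<zeta> assume "\<zeta> \<in> hplane \<xi>"
    then show "\<phi> \<zeta> \<ge> \<phi> \<xi> + p \<bullet> (Pr1 \<zeta> - Pr1 \<xi>)"
      using R[rule_format, of "Pr1 \<zeta> - Pr1 \<xi>"] hplane_iff[of \<zeta> \<xi>] by simp
  qed
qed

lemma H_subdiffD: "p \<in> H_subdiff \<phi> \<xi> \<Longrightarrow> \<phi> \<xi> + p \<bullet> h \<le> \<phi> (\<xi> \<odot> hexp h)"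
  using H_subdiff_iff by blast

text \<open>Testing a subgradient \<open>p\<close> in its own direction \<open>sgn p\<close> yields
  \<open>norm p\<close> on the left of the Lipschitz bound.\<close>

lemma H_subdiff_bounded:
  assumes H: "H_convex \<phi>" and A: "bounded A"
  shows "\<exists>L. \<forall>\<xi>\<in>A. \<forall>p\<in>H_subdiff \<phi> \<xi>. norm p \<le> L"
proof -
  obtain L where L: "L \<ge> 0" "\<And>\<xi> h. \<xi> \<in> A \<Longrightarrow> norm h \<le> 1 \<Longrightarrow> \<phi> (\<xi> \<odot> hexp h) - \<phi> \<xi> \<le> L * norm h"
    using H_convex_increment_le[OF H A] by metis
  have "norm p \<le> L" if "\<xi> \<in> A" "p \<in> H_subdiff \<phi> \<xi>" for \<xi> p
  proof -
    have "norm (sgn p) \<le> 1" by (simp add: norm_sgn)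
    then have "p \<bullet> sgn p \<le> L * norm (sgn p)"
      using H_subdiffD[OF that(2), of "sgn p"] L(2)[OF that(1), of "sgn p"] by linarith
    also have "\<dots> \<le> L * 1" using L(1) by (intro mult_left_mono) (simp_all add: norm_sgn)
    also have "p \<bullet> sgn p = norm p"
      by (cases "p = 0") (simp_all add: sgn_div_norm dot_square_norm power2_eq_square)
    finally show ?thesis by simp
  qed
  then show ?thesis by blast
qed

text \<open>Subgradients are locally bounded, so a subsequence converges; continuity of
  \<open>\<phi>\<close> passes the subgradient inequality to the limit for each
  \<open>h\<close>.\<close>

lemma H_subdiff_subsequence:
  fixes \<phi> :: "'n::finite heis \<Rightarrow> real"
  assumes H: "H_convex \<phi>" and \<eta>: "\<eta> \<longlonglongrightarrow> \<xi>" and p: "\<And>k :: nat. p k \<in> H_subdiff \<phi> (\<eta> k)"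
  shows "\<exists>l r. strict_mono r \<and> (p \<circ> r) \<longlonglongrightarrow> l \<and> l \<in> H_subdiff \<phi> \<xi>"
proof -
  have "bounded (range \<eta>)" using \<eta> by (rule convergent_imp_bounded)
  from H_subdiff_bounded[OF H this] obtain L where "\<And>k. norm (p k) \<le> L"
    using p by (metis rangeI)
  then have "bounded (range p)" by (auto simp: bounded_iff)
  then obtain l r where r: "strict_mono r" "(p \<circ> r) \<longlonglongrightarrow> l"
    using bounded_imp_convergent_subsequence by blast
  have \<eta>r: "(\<lambda>k. \<eta> (r k)) \<longlonglongrightarrow> \<xi>"
    using LIMSEQ_subseq_LIMSEQ[OF \<eta> r(1)] by (simp add: o_def)
  have "\<phi> \<xi> + l \<bullet> h \<le> \<phi> (\<xi> \<odot> hexp h)" for h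
  proof (rule LIMSEQ_le)
    show "(\<lambda>k. \<phi> (\<eta> (r k)) + (p \<circ> r) k \<bullet> h) \<longlonglongrightarrow> \<phi> \<xi> + l \<bullet> h"
      by (intro tendsto_intros r(2) isCont_tendsto_compose[OF H_convex_isCont[OF H]] \<eta>r)
    have "(\<lambda>k. \<eta> (r k) \<odot> hexp h) \<longlonglongrightarrow> \<xi> \<odot> hexp h"
      unfolding hmult_hexp_eq by (intro tendsto_intros \<eta>r)
    then show "(\<lambda>k. \<phi> (\<eta> (r k) \<odot> hexp h)) \<longlonglongrightarrow> \<phi> (\<xi> \<odot> hexp h)"
      by (rule isCont_tendsto_compose[OF H_convex_isCont[OF H]])
    show "\<exists>N. \<forall>k\<ge>N. \<phi> (\<eta> (r k)) + (p \<circ> r) k \<bullet> h \<le> \<phi> (\<eta> (r k) \<odot> hexp h)"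
      using H_subdiffD[OF p] by auto
  qed
  then show ?thesis using r H_subdiff_iff by blast
qed

text \<open>Minimality controls \<open>\<phi>\<close> only near \<open>\<eta>\<close>, but convexity
  along horizontal lines makes the local slope bound global.\<close>

lemma H_subdiff_touching:
  fixes \<phi> :: "'n::finite heis \<Rightarrow> real"
  assumes H: "H_convex \<phi>" and \<eta>: "\<eta> \<in> ball \<xi> r"
    and min: "\<And>\<zeta>. \<zeta> \<in> ball \<xi> r \<Longrightarrow> \<phi> \<eta> + c * (norm (\<eta> - \<xi>))\<^sup>2 \<le> \<phi> \<zeta> + c * (norm (\<zeta> - \<xi>))\<^sup>2"
  shows "H_subdiff \<phi> \<eta> \<noteq> {}"
proof -
  define d where "d = \<eta> - \<xi>"
  \<comment> \<open>The derivatives of \<open>- c * (norm (\<zeta> - \<xi>))\<^sup>2\<close> at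
    \<open>\<eta>\<close> along the left-invariant horizontal fields.\<close>
  define p :: "'n hvec" where
    "p = (- 2 * c) *\<^sub>R (fst d + (2 * snd (snd d)) *\<^sub>R fst (snd \<eta>), fst (snd d) - (2 * snd (snd d)) *\<^sub>R fst \<eta>)"
  have "\<phi> \<eta> + p \<bullet> h \<le> \<phi> (\<eta> \<odot> hexp h)" for h
  proof -
    \<comment> \<open>The Euclidean direction of the horizontal line, which is a straight
      line.\<close>
    define l where "l = (fst h, snd h, 2 * (fst h \<bullet> fst (snd \<eta>) - fst \<eta> \<bullet> snd h))"
    have line: "\<eta> \<odot> hexp (s *\<^sub>R h) = \<eta> + s *\<^sub>R l" for s
      by (cases \<eta>) (simp add: hmult_hexp_eq l_def right_diff_distrib)
    have pl: "p \<bullet> h = - 2 * c * (d \<bullet> l)"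
      by (cases \<eta>; cases d; cases h) (simp add: p_def l_def inner_simps inner_commute algebra_simps)
    have "((\<lambda>s. \<eta> + s *\<^sub>R l) \<longlongrightarrow> \<eta> + 0 *\<^sub>R l) (at_right 0)"
      by (intro tendsto_intros)
    then have "\<forall>\<^sub>F s in at_right 0. \<eta> + s *\<^sub>R l \<in> ball \<xi> r"
      using \<eta> by (intro topological_tendstoD) auto
    moreover have "\<forall>\<^sub>F s in at_right 0. s \<in> {0<..<1::real}"
      by (rule eventually_at_right_real) simp
    \<comment> \<open>Minimality bounds \<open>\<phi>\<close> at parameter \<open>s\<close> from
      below and convexity bounds it by the value at parameter 1. Division by \<open>s\<close> leaves
      an error of order \<open>s\<close>.\<close>
    ultimately have "\<forall>\<^sub>F s in at_right 0. - 2 * c * (d \<bullet> l) - c * s * (l \<bullet> l) \<le> \<phi> (\<eta> \<odot> hexp h) - \<phi> \<eta>"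
    proof eventually_elim
      case (elim s)
      have "\<phi> \<eta> + c * (norm d)\<^sup>2 \<le> \<phi> (\<eta> + s *\<^sub>R l) + c * (norm (d + s *\<^sub>R l))\<^sup>2"
        using min[OF elim(1)] by (simp add: d_def algebra_simps)
      also have "(norm (d + s *\<^sub>R l))\<^sup>2 = (norm d)\<^sup>2 + s * (2 * (d \<bullet> l) + s * (l \<bullet> l))"
        by (simp add: power2_norm_eq_inner inner_simps inner_commute algebra_simps)
      also have "\<phi> (\<eta> + s *\<^sub>R l) \<le> (1 - s) * \<phi> \<eta> + s * \<phi> (\<eta> \<odot> hexp h)"
        using H_convexD[OF H, of s \<eta> h] elim(2) by (simp add: line)
      finally have "s * (- 2 * c * (d \<bullet> l) - c * s * (l \<bullet> l)) \<le> s * (\<phi> (\<eta> \<odot> hexp h) - \<phi> \<eta>)"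
        by (simp add: algebra_simps)
      then show ?case using elim(2) by simp
    qed
    moreover have "((\<lambda>s. - 2 * c * (d \<bullet> l) - c * s * (l \<bullet> l)) \<longlongrightarrow> - 2 * c * (d \<bullet> l) - c * 0 * (l \<bullet> l)) (at_right 0)"
      by (intro tendsto_intros)
    ultimately have "- 2 * c * (d \<bullet> l) - c * 0 * (l \<bullet> l) \<le> \<phi> (\<eta> \<odot> hexp h) - \<phi> \<eta>"
      by (intro tendsto_upperbound[where F = "at_right 0"]) auto
    then show ?thesis by (simp add: pl)
  qed
  then show ?thesis using H_subdiff_iff by blast
qed

lemma H_subdiff_dense:
  fixes \<phi> :: "'n::finite heis \<Rightarrow> real"
  assumes H: "H_convex \<phi>" and "\<epsilon> > 0"
  shows "\<exists>\<eta>. dist \<eta> \<xi> < \<epsilon> \<and> H_subdiff \<phi> \<eta> \<noteq> {}"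
proof -
  obtain m where m: "\<And>\<zeta>. \<zeta> \<in> cball \<xi> \<epsilon> \<Longrightarrow> m \<le> \<phi> \<zeta>"
    using H_convex_bounded_below[OF H bounded_cball] by blast
  \<comment> \<open>On the sphere of radius \<open>\<epsilon>\<close> the penalty exceeds
    \<open>\<phi> \<xi> - m\<close>, which forces the minimum into the open ball.\<close>
  define c where "c = (\<bar>\<phi> \<xi> - m\<bar> + 1) / \<epsilon>\<^sup>2"
  have c: "c > 0" "c * \<epsilon>\<^sup>2 = \<bar>\<phi> \<xi> - m\<bar> + 1" using \<open>\<epsilon> > 0\<close> by (auto simp: c_def)
  have "continuous_on (cball \<xi> \<epsilon>) (\<lambda>\<zeta>. \<phi> \<zeta> + c * (norm (\<zeta> - \<xi>))\<^sup>2)"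
    by (intro continuous_intros continuous_at_imp_continuous_on ballI H_convex_isCont[OF H])
  then obtain \<eta> where \<eta>: "\<eta> \<in> cball \<xi> \<epsilon>"
    "\<And>\<zeta>. \<zeta> \<in> cball \<xi> \<epsilon> \<Longrightarrow> \<phi> \<eta> + c * (norm (\<eta> - \<xi>))\<^sup>2 \<le> \<phi> \<zeta> + c * (norm (\<zeta> - \<xi>))\<^sup>2"
    using continuous_attains_inf[of "cball \<xi> \<epsilon>"] \<open>\<epsilon> > 0\<close>
    by (metis (no_types, lifting) compact_cball cball_eq_empty less_le_not_le less_imp_le)
  have "c * (norm (\<eta> - \<xi>))\<^sup>2 \<le> \<phi> \<xi> - m"
    using \<eta>(2)[of \<xi>] m[OF \<eta>(1)] \<open>\<epsilon> > 0\<close> by simp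
  then have "c * (norm (\<eta> - \<xi>))\<^sup>2 < c * \<epsilon>\<^sup>2" using c by linarith
  then have "(norm (\<eta> - \<xi>))\<^sup>2 < \<epsilon>\<^sup>2" using c(1) by (simp only: mult_less_cancel_left_pos)
  then have "dist \<eta> \<xi> < \<epsilon>"
    using \<open>\<epsilon> > 0\<close> by (simp add: dist_norm power_less_imp_less_base)
  moreover from this have "H_subdiff \<phi> \<eta> \<noteq> {}"
    using \<eta>(2) by (intro H_subdiff_touching[OF H, of _ \<xi> \<epsilon> c]) (auto simp: dist_commute)
  ultimately show ?thesis by blast
qed

lemma LIMSEQ_dist_less_inverse:
  assumes "\<And>k. dist (f k) l < inverse (real (Suc k))"
  shows "f \<longlonglongrightarrow> l"
proof -
  have "(\<lambda>k. dist (f k) l) \<longlonglongrightarrow> 0"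
    by (rule tendsto_sandwich[OF _ _ tendsto_const LIMSEQ_inverse_real_of_nat])
       (use assms in \<open>auto intro!: always_eventually less_imp_le simp del: of_nat_Suc\<close>)
  then show ?thesis by (rule tendsto_dist_iff[THEN iffD2])
qed

text \<open>Subgradients at base points tending to \<open>\<xi>\<close> accumulate at a subgradient
  at \<open>\<xi>\<close>.\<close>

lemma H_subdiff_nonempty:
  fixes \<phi> :: "'n::finite heis \<Rightarrow> real"
  assumes H: "H_convex \<phi>"
  shows "H_subdiff \<phi> \<xi> \<noteq> {}"
proof -
  have "\<forall>k. \<exists>\<eta> p. dist \<eta> \<xi> < inverse (real (Suc k)) \<and> p \<in> H_subdiff \<phi> \<eta>"
  proof
    fix k show "\<exists>\<eta> p. dist \<eta> \<xi> < inverse (real (Suc k)) \<and> p \<in> H_subdiff \<phi> \<eta>"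
      using H_subdiff_dense[OF H, of "inverse (real (Suc k))" \<xi>] by force
  qed
  then obtain \<eta> p where \<eta>: "\<And>k. dist (\<eta> k) \<xi> < inverse (real (Suc k))"
    and p: "\<And>k. p k \<in> H_subdiff \<phi> (\<eta> k)" by metis
  from \<eta> have "\<eta> \<longlonglongrightarrow> \<xi>" by (rule LIMSEQ_dist_less_inverse)
  from H_subdiff_subsequence[where p = p, OF H this p] show ?thesis by blast
qed

text \<open>Otherwise subgradients at points tending to \<open>\<xi>\<close> stay away from
  \<open>g\<close>, while a limit of a subsequence must be \<open>g\<close>.\<close>

lemma H_subdiff_singleton_continuous:
  fixes \<phi> :: "'n::finite heis \<Rightarrow> real"
  assumes H: "H_convex \<phi>" and g: "H_subdiff \<phi> \<xi> = {g}" and "\<epsilon> > 0"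
  shows "\<exists>\<delta>>0. \<forall>\<eta>. dist \<eta> \<xi> < \<delta> \<longrightarrow> (\<forall>p\<in>H_subdiff \<phi> \<eta>. norm (p - g) < \<epsilon>)"
proof (rule ccontr)
  assume "\<not> ?thesis"
  then have "\<forall>k::nat. \<exists>\<eta> p. dist \<eta> \<xi> < inverse (real (Suc k)) \<and> p \<in> H_subdiff \<phi> \<eta> \<and> \<epsilon> \<le> norm (p - g)"
    by (metis inverse_positive_iff_positive of_nat_0_less_iff zero_less_Suc not_less)
  then obtain \<eta> p where \<eta>: "\<And>k::nat. dist (\<eta> k) \<xi> < inverse (real (Suc k))"
    and p: "\<And>k. p k \<in> H_subdiff \<phi> (\<eta> k)" and \<epsilon>: "\<And>k. \<epsilon> \<le> norm (p k - g)" by metis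
  from \<eta> have "\<eta> \<longlonglongrightarrow> \<xi>" by (rule LIMSEQ_dist_less_inverse)
  from H_subdiff_subsequence[where p = p, OF H this p] obtain r where "(p \<circ> r) \<longlonglongrightarrow> g"
    using g by auto
  then have "(\<lambda>k. norm ((p \<circ> r) k - g)) \<longlonglongrightarrow> norm (g - g)"
    by (intro tendsto_intros)
  then have "\<epsilon> \<le> norm (g - g)"
    by (rule LIMSEQ_le_const) (use \<epsilon> in auto)
  then show False using \<open>\<epsilon> > 0\<close> by simp
qed

section \<open>From unique subgradients to differentiability\<close>

lemma hmult_hexp_near:
  fixes \<xi> :: "'n::finite heis"
  assumes "\<delta> > 0"
  shows "\<exists>\<gamma>>0. \<gamma> \<le> \<delta> \<and> (\<forall>\<eta> h. dist \<eta> \<xi> < \<gamma> \<longrightarrow> norm h < \<gamma> \<longrightarrow> dist (\<eta> \<odot> hexp h) \<xi> < \<delta>)"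
proof -
  have "isCont (\<lambda>(\<eta>, h). \<eta> \<odot> hexp h) (\<xi>, 0)"
    using continuous_on_hmult_hexp[of UNIV] continuous_on_eq_continuous_at[OF open_UNIV] by blast
  then obtain e where e: "e > 0" "\<And>x. dist x (\<xi>, 0) < e \<Longrightarrow> dist (case x of (\<eta>, h) \<Rightarrow> \<eta> \<odot> hexp h) \<xi> < \<delta>"
    unfolding continuous_at_eps_delta using assms by (auto simp: hmult_he)
  have "dist (\<eta> \<odot> hexp h) \<xi> < \<delta>" if "dist \<eta> \<xi> < min \<delta> (e / 2)" "norm h < min \<delta> (e / 2)" for \<eta> h
  proof -
    have "dist (\<eta>, h) (\<xi>, 0) \<le> dist \<eta> \<xi> + norm h"
      by (simp add: dist_Pair_Pair sqrt_sum_squares_le_sum)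
    then show ?thesis using e(2)[of "(\<eta>, h)"] that by simp
  qed
  then show ?thesis using assms e(1) by (intro exI[of _ "min \<delta> (e / 2)"]) auto
qed

text \<open>The subgradient inequalities at both ends of a horizontal segment estimate the increment of
  \<open>\<phi>\<close> from below and from above.\<close>

lemma H_subdiff_increment:
  assumes p: "p \<in> H_subdiff \<phi> \<eta>" "norm (p - g) \<le> \<epsilon>"
    and q: "q \<in> H_subdiff \<phi> (\<eta> \<odot> hexp h)" "norm (q - g) \<le> \<epsilon>"
  shows "\<bar>\<phi> (\<eta> \<odot> hexp h) - \<phi> \<eta> - g \<bullet> h\<bar> \<le> \<epsilon> * norm h"
proof -
  have b: "\<bar>(x - g) \<bullet> h\<bar> \<le> \<epsilon> * norm h" if "norm (x - g) \<le> \<epsilon>" for x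
    by (rule order_trans[OF Cauchy_Schwarz_ineq2 mult_right_mono[OF that norm_ge_zero]])
  show ?thesis
    using H_subdiffD[OF p(1), of h] H_subdiffD[OF q(1), of "- h"] b[OF p(2)] b[OF q(2)]
    by (simp add: inner_diff_left abs_le_iff)
qed

text \<open>Near \<open>\<xi>\<close> all subgradients are close to \<open>g\<close>, so each of the
  four horizontal moves to \<open>\<xi> \<odot> \<zeta>\<close> has an increment close to the linear
  one.\<close>

lemma H_differentiable_of_singleton_subdiff:
  fixes \<phi> :: "'n::finite heis \<Rightarrow> real"
  assumes H: "H_convex \<phi>" and sing: "\<And>\<xi>. \<exists>g. H_subdiff \<phi> \<xi> = {g}"
  shows "H_differentiable \<phi>"
  unfolding H_differentiable_def
proof
  fix \<xi> :: "'n heis"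
  obtain g where g: "H_subdiff \<phi> \<xi> = {g}" using sing by blast
  have "(\<lambda>\<zeta>. \<phi> (\<xi> \<odot> \<zeta>) - \<phi> \<xi> - g \<bullet> Pr1 \<zeta>) \<in> o[at he](gauge_norm)"
  proof (rule landau_o.smallI)
    fix c :: real assume "c > 0"
    \<comment> \<open>Four moves of length at most twice the gauge norm add up to the factor
      8.\<close>
    then have "c / 8 > 0" by simp
    then obtain \<delta> where \<delta>: "\<delta> > 0" "\<And>\<eta> p. dist \<eta> \<xi> < \<delta> \<Longrightarrow> p \<in> H_subdiff \<phi> \<eta> \<Longrightarrow> norm (p - g) < c / 8"
      using H_subdiff_singleton_continuous[OF H g] by metis
    \<comment> \<open>The radii are nested backwards: each move of length below \<open>d4\<close>
      leads into the next larger ball, so all points of the path stay within \<open>\<delta>\<close>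
      of \<open>\<xi>\<close>.\<close>
    obtain d1 where d1: "d1 > 0" "d1 \<le> \<delta>" "\<And>\<eta> h. dist \<eta> \<xi> < d1 \<Longrightarrow> norm h < d1 \<Longrightarrow> dist (\<eta> \<odot> hexp h) \<xi> < \<delta>"
      using hmult_hexp_near[OF \<delta>(1)] by metis
    obtain d2 where d2: "d2 > 0" "d2 \<le> d1" "\<And>\<eta> h. dist \<eta> \<xi> < d2 \<Longrightarrow> norm h < d2 \<Longrightarrow> dist (\<eta> \<odot> hexp h) \<xi> < d1"
      using hmult_hexp_near[OF d1(1)] by metis
    obtain d3 where d3: "d3 > 0" "d3 \<le> d2" "\<And>\<eta> h. dist \<eta> \<xi> < d3 \<Longrightarrow> norm h < d3 \<Longrightarrow> dist (\<eta> \<odot> hexp h) \<xi> < d2"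
      using hmult_hexp_near[OF d2(1)] by metis
    obtain d4 where d4: "d4 > 0" "d4 \<le> d3" "\<And>\<eta> h. dist \<eta> \<xi> < d4 \<Longrightarrow> norm h < d4 \<Longrightarrow> dist (\<eta> \<odot> hexp h) \<xi> < d3"
      using hmult_hexp_near[OF d3(1)] by metis
    have "((\<lambda>\<zeta>::'n heis. gauge_norm (hinv he \<odot> \<zeta>)) \<longlongrightarrow> 0) (at he)"
      by (rule tendsto_gauge_norm)
    then have "(gauge_norm \<longlongrightarrow> 0) (at (he :: 'n heis))"
      by (simp add: hmult_he hinv_he)
    then have "\<forall>\<^sub>F \<zeta> in at (he :: 'n heis). gauge_norm \<zeta> < d4 / 2"
      using d4(1) by (intro order_tendstoD) auto
    then show "\<forall>\<^sub>F \<zeta> in at he. norm (\<phi> (\<xi> \<odot> \<zeta>) - \<phi> \<xi> - g \<bullet> Pr1 \<zeta>) \<le> c * norm (gauge_norm \<zeta>)"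
    proof eventually_elim
      case (elim \<zeta>)
      obtain h1 h2 h3 h4 where h:
        "\<zeta> = hexp h1 \<odot> hexp h2 \<odot> hexp h3 \<odot> hexp h4" "Pr1 \<zeta> = h1 + h2 + h3 + h4"
        "norm h1 \<le> 2 * gauge_norm \<zeta>" "norm h2 \<le> 2 * gauge_norm \<zeta>"
        "norm h3 \<le> 2 * gauge_norm \<zeta>" "norm h4 \<le> 2 * gauge_norm \<zeta>"
        by (rule horizontal_decomposition)
      define a1 a2 a3 where "a1 = \<xi> \<odot> hexp h1" and "a2 = a1 \<odot> hexp h2" and "a3 = a2 \<odot> hexp h3"
      have a4: "\<xi> \<odot> \<zeta> = a3 \<odot> hexp h4"
        by (simp add: a1_def a2_def a3_def hmult_assoc h(1))
      have D1: "dist a1 \<xi> < d3" unfolding a1_def using h(3) elim d4 by (intro d4(3)) auto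
      have D2: "dist a2 \<xi> < d2" unfolding a2_def using h(4) elim d4 by (intro d3(3) D1) auto
      have D3: "dist a3 \<xi> < d1" unfolding a3_def using h(5) elim d4 d3 by (intro d2(3) D2) auto
      have D4: "dist (a3 \<odot> hexp h4) \<xi> < \<delta>" using h(6) elim d4 d3 d2 by (intro d1(3) D3) auto
      have D: "dist \<xi> \<xi> < \<delta>" "dist a1 \<xi> < \<delta>" "dist a2 \<xi> < \<delta>" "dist a3 \<xi> < \<delta>"
        using D1 D2 D3 \<delta>(1) d1(2) d2(2) d3(2) by auto
      have step: "\<bar>\<phi> (\<eta> \<odot> hexp h) - \<phi> \<eta> - g \<bullet> h\<bar> \<le> c / 4 * gauge_norm \<zeta>"
        if "dist \<eta> \<xi> < \<delta>" "dist (\<eta> \<odot> hexp h) \<xi> < \<delta>" "norm h \<le> 2 * gauge_norm \<zeta>" for \<eta> h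
      proof -
        obtain p q where pq: "p \<in> H_subdiff \<phi> \<eta>" "q \<in> H_subdiff \<phi> (\<eta> \<odot> hexp h)"
          using H_subdiff_nonempty[OF H] by blast
        have "\<bar>\<phi> (\<eta> \<odot> hexp h) - \<phi> \<eta> - g \<bullet> h\<bar> \<le> c / 8 * norm h"
          using pq \<delta>(2)[OF that(1) pq(1)] \<delta>(2)[OF that(2) pq(2)] by (intro H_subdiff_increment) auto
        also have "\<dots> \<le> c / 8 * (2 * gauge_norm \<zeta>)"
          using that(3) \<open>c > 0\<close> by (intro mult_left_mono) auto
        finally show ?thesis by simp
      qed
      have "\<bar>\<phi> a1 - \<phi> \<xi> - g \<bullet> h1\<bar> \<le> c / 4 * gauge_norm \<zeta>"
        "\<bar>\<phi> a2 - \<phi> a1 - g \<bullet> h2\<bar> \<le> c / 4 * gauge_norm \<zeta>"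
        "\<bar>\<phi> a3 - \<phi> a2 - g \<bullet> h3\<bar> \<le> c / 4 * gauge_norm \<zeta>"
        "\<bar>\<phi> (\<xi> \<odot> \<zeta>) - \<phi> a3 - g \<bullet> h4\<bar> \<le> c / 4 * gauge_norm \<zeta>"
        using step[of \<xi> h1] step[of a1 h2] step[of a2 h3] step[of a3 h4] D D4 h(3-6)
        by (simp_all only: a1_def[symmetric] a2_def[symmetric] a3_def[symmetric] a4)
      moreover have "\<bar>y - x - (u1 + u2 + u3 + u4)\<bar> \<le> 4 * e"
        if "\<bar>b1 - x - u1\<bar> \<le> e" "\<bar>b2 - b1 - u2\<bar> \<le> e" "\<bar>b3 - b2 - u3\<bar> \<le> e" "\<bar>y - b3 - u4\<bar> \<le> e"
        for b1 b2 b3 e u1 u2 u3 u4 x y :: real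
        using that by linarith
      ultimately have "\<bar>\<phi> (\<xi> \<odot> \<zeta>) - \<phi> \<xi> - (g \<bullet> h1 + g \<bullet> h2 + g \<bullet> h3 + g \<bullet> h4)\<bar>
          \<le> 4 * (c / 4 * gauge_norm \<zeta>)" by blast
      then show ?case by (simp add: h(2) inner_add_right)
    qed
  qed
  then show "\<exists>g. (\<lambda>\<zeta>. \<phi> (\<xi> \<odot> \<zeta>) - \<phi> \<xi> - g \<bullet> Pr1 \<zeta>) \<in> o[at he](gauge_norm)" by blast
qed

subsection \<open>The engulfing property\<close>

definition gap :: "('n::finite heis \<Rightarrow> real) \<Rightarrow> 'n heis \<Rightarrow> 'n hvec \<Rightarrow> 'n heis \<Rightarrow> real" where
  "gap \<phi> \<xi> p \<zeta> = \<phi> \<zeta> - \<phi> \<xi> - p \<bullet> (Pr1 \<zeta> - Pr1 \<xi>)"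

text \<open>One inequality suffices: the relation of lying in each other's plane is symmetric, so
  swapping the points gives the reverse estimate.\<close>

definition gap_quasisymmetric :: "('n::finite heis \<Rightarrow> real) \<Rightarrow> real \<Rightarrow> bool" where
  "gap_quasisymmetric \<phi> K \<longleftrightarrow> (\<forall>\<xi>. \<forall>\<zeta>\<in>hplane \<xi>. \<forall>p\<in>H_subdiff \<phi> \<xi>. \<forall>q\<in>H_subdiff \<phi> \<zeta>.
     gap \<phi> \<zeta> q \<xi> \<le> K * gap \<phi> \<xi> p \<zeta>)"

lemma H_section_gap: "\<zeta> \<in> H_section \<phi> \<xi> p s \<longleftrightarrow> \<zeta> \<in> hplane \<xi> \<and> gap \<phi> \<xi> p \<zeta> < s"
  by (simp add: H_section_def gap_def)

text \<open>The condition is linear in \<open>h\<close>, so with two points of a horizontal line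
  also their midpoint lies in the plane.\<close>

lemma hmult_hexp_in_hplane_iff:
  assumes "\<zeta> \<in> hplane \<xi>"
  shows "\<zeta> \<odot> hexp h \<in> hplane \<xi> \<longleftrightarrow>
    fst h \<bullet> (fst (snd \<zeta>) - fst (snd \<xi>)) = (fst \<zeta> - fst \<xi>) \<bullet> snd h"
  using assms by (cases \<xi>; cases \<zeta>) (auto simp: hmult_hexp_eq inner_simps inner_commute)

lemma hplane_sym: "\<zeta> \<in> hplane \<xi> \<Longrightarrow> \<xi> \<in> hplane \<zeta>"
  by (metis hplaneE hmult_hexp_cancel(1) hmult_hexp_in_hplane)

lemma hplane_self: "\<xi> \<in> hplane \<xi>"
  by (simp add: hplane_iff hmult_he)

lemma gap_nonneg: "p \<in> H_subdiff \<phi> \<xi> \<Longrightarrow> \<zeta> \<in> hplane \<xi> \<Longrightarrow> 0 \<le> gap \<phi> \<xi> p \<zeta>"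
  by (auto simp: H_subdiff_def gap_def)

text \<open>The values of \<open>\<phi>\<close> cancel; this links the middle term of (iii) to the
  two gaps.\<close>

lemma gap_add_gap: "gap \<phi> \<xi> p \<zeta> + gap \<phi> \<zeta> q \<xi> = (q - p) \<bullet> (Pr1 \<zeta> - Pr1 \<xi>)"
  by (simp add: gap_def inner_simps)

text \<open>The centre \<open>\<xi>\<close> itself is among the engulfed points.\<close>

lemma engulfing_imp_section_symmetric:
  assumes "engulfing \<phi> K" "p \<in> H_subdiff \<phi> \<xi>" "q \<in> H_subdiff \<phi> \<zeta>" "s > 0" "\<zeta> \<in> H_section \<phi> \<xi> p s"
  shows "\<xi> \<in> H_section \<phi> \<zeta> q (K * s)"
proof -
  have "\<xi> \<in> H_section \<phi> \<xi> p s \<inter> hplane \<zeta>"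
    using assms by (simp add: H_section_gap hplane_self hplane_sym gap_def)
  then show ?thesis using assms unfolding engulfing_def by blast
qed

text \<open>The point \<open>\<zeta>\<close> lies in every section of height \<open>s\<close> above
  its gap; let \<open>s\<close> decrease to that gap.\<close>

lemma gap_quasisymmetric_of_sections:
  assumes "K > 0" and S: "\<And>\<xi> \<zeta> p q s. p \<in> H_subdiff \<phi> \<xi> \<Longrightarrow> q \<in> H_subdiff \<phi> \<zeta> \<Longrightarrow> s > 0 \<Longrightarrow>
    \<zeta> \<in> H_section \<phi> \<xi> p s \<Longrightarrow> \<xi> \<in> H_section \<phi> \<zeta> q (K * s)"
  shows "gap_quasisymmetric \<phi> K"
  unfolding gap_quasisymmetric_def
proof (intro allI ballI)
  fix \<xi> \<zeta> p q assume *: "\<zeta> \<in> hplane \<xi>" "p \<in> H_subdiff \<phi> \<xi>" "q \<in> H_subdiff \<phi> \<zeta>"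
  have "gap \<phi> \<zeta> q \<xi> / K \<le> s" if "s > gap \<phi> \<xi> p \<zeta>" for s
  proof -
    have "gap \<phi> \<zeta> q \<xi> < K * s"
      using S[OF *(2,3), of s] gap_nonneg[OF *(2,1)] that *(1) by (simp add: H_section_gap)
    then show ?thesis using \<open>K > 0\<close> by (simp add: divide_simps mult.commute)
  qed
  then have "gap \<phi> \<zeta> q \<xi> / K \<le> gap \<phi> \<xi> p \<zeta>" by (rule dense_ge)
  then show "gap \<phi> \<zeta> q \<xi> \<le> K * gap \<phi> \<xi> p \<zeta>" using \<open>K > 0\<close> by (simp add: divide_simps mult.commute)
qed

text \<open>Subtracting one gap from the sum of both turns the upper bound into quasisymmetry and
  the lower bound into quasisymmetry with the points exchanged.\<close>

lemma gap_quasisymmetric_iff: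
  assumes "K > 0"
  shows "gap_quasisymmetric \<phi> K \<longleftrightarrow> (\<forall>\<xi>. \<forall>\<zeta>\<in>hplane \<xi>. \<forall>p\<in>H_subdiff \<phi> \<xi>. \<forall>q\<in>H_subdiff \<phi> \<zeta>.
      (K + 1) / K * gap \<phi> \<xi> p \<zeta> \<le> (q - p) \<bullet> (Pr1 \<zeta> - Pr1 \<xi>) \<and>
      (q - p) \<bullet> (Pr1 \<zeta> - Pr1 \<xi>) \<le> (K + 1) * gap \<phi> \<xi> p \<zeta>)"
    (is "_ \<longleftrightarrow> (\<forall>\<xi>. \<forall>\<zeta>\<in>hplane \<xi>. \<forall>p\<in>_. \<forall>q\<in>_. ?P \<xi> \<zeta> p q)")
proof -
  have "?P \<xi> \<zeta> p q \<longleftrightarrow> gap \<phi> \<xi> p \<zeta> \<le> K * gap \<phi> \<zeta> q \<xi> \<and> gap \<phi> \<zeta> q \<xi> \<le> K * gap \<phi> \<xi> p \<zeta>" for \<xi> \<zeta> p q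
    unfolding gap_add_gap[of \<phi> \<xi> p \<zeta> q, symmetric] using assms by (simp add: field_simps)
  then show ?thesis
    unfolding gap_quasisymmetric_def using hplane_sym by blast
qed

text \<open>With a subgradient \<open>r\<close> at the midpoint \<open>m\<close> of \<open>\<zeta>\<close> and \<open>\<eta>\<close>, everything is bounded by the second
  difference \<open>\<phi> \<zeta> + \<phi> \<eta> - 2 * \<phi> m\<close>, which is less than \<open>2 * s\<close> as \<open>m\<close> lies in \<open>hplane \<xi>\<close>.\<close>

lemma gap_quasisymmetric_imp_engulfing:
  fixes \<phi> :: "'n::finite heis \<Rightarrow> real"
  assumes H: "H_convex \<phi>" and Q: "gap_quasisymmetric \<phi> K" and K: "K > 0"
  shows "engulfing \<phi> (2 * (1 + K * (K + 2)))"
  unfolding engulfing_def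
proof (intro allI ballI impI subsetI)
  fix \<xi> \<zeta> \<eta> :: "'n heis" and p q s
  assume p: "p \<in> H_subdiff \<phi> \<xi>" and s: "s > 0" and \<zeta>: "\<zeta> \<in> H_section \<phi> \<xi> p s"
    and q: "q \<in> H_subdiff \<phi> \<zeta>" and \<eta>: "\<eta> \<in> H_section \<phi> \<xi> p s \<inter> hplane \<zeta>"
  define u where "u = (1/2) *\<^sub>R (Pr1 \<eta> - Pr1 \<zeta>)"
  define m where "m = \<zeta> \<odot> hexp u"
  have m\<eta>: "\<eta> = m \<odot> hexp u"
  proof -
    have "\<eta> = \<zeta> \<odot> hexp (Pr1 \<eta> - Pr1 \<zeta>)" using \<eta> hplane_iff by blast
    also have "\<dots> = m \<odot> hexp u"
      unfolding m_def u_def hmult_hexp_hexp_scaled by simp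
    finally show ?thesis .
  qed
  have m\<zeta>: "\<zeta> = m \<odot> hexp (- u)" by (simp add: m_def)
  have Pr: "Pr1 \<eta> = Pr1 m + u" "Pr1 \<zeta> = Pr1 m - u"
    by (simp_all add: m\<eta> m_def)
  have m\<xi>: "m \<in> hplane \<xi>"
  proof -
    have "\<zeta> \<odot> hexp (2 *\<^sub>R u) = \<eta>"
      using \<eta> hplane_iff[of \<eta> \<zeta>] by (simp add: u_def)
    then have "\<zeta> \<in> hplane \<xi>" "\<zeta> \<odot> hexp (2 *\<^sub>R u) \<in> hplane \<xi>" using \<zeta> \<eta> by (auto simp: H_section_gap)
    then show ?thesis
      unfolding m_def by (simp add: hmult_hexp_in_hplane_iff)
  qed
  define S where "S = \<phi> \<zeta> + \<phi> \<eta> - 2 * \<phi> m"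
  \<comment> \<open>The linear terms in \<open>p\<close> cancel at a midpoint, so \<open>S\<close>
    is also the second difference of the gap at \<open>\<xi>\<close>.\<close>
  have S: "S < 2 * s"
  proof -
    have "S = gap \<phi> \<xi> p \<zeta> + gap \<phi> \<xi> p \<eta> - 2 * gap \<phi> \<xi> p m"
      by (simp add: S_def gap_def Pr inner_simps)
    then show ?thesis
      using \<zeta> \<eta> gap_nonneg[OF p m\<xi>] by (auto simp: H_section_gap)
  qed
  obtain r where r: "r \<in> H_subdiff \<phi> m" using H_subdiff_nonempty[OF H] by blast
  have r1: "\<phi> m + r \<bullet> u \<le> \<phi> \<eta>" "\<phi> m - r \<bullet> u \<le> \<phi> \<zeta>"
    using H_subdiffD[OF r, of u] H_subdiffD[OF r, of "- u"] by (simp_all add: m\<eta>[symmetric] m\<zeta>[symmetric])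
  have m\<zeta>': "\<zeta> \<in> hplane m" "m \<in> hplane \<zeta>" by (simp_all add: m_def hplane_sym)
  have mz: "gap \<phi> m r \<zeta> \<le> S" using r1 by (simp add: gap_def Pr S_def)
  have me: "gap \<phi> m r \<eta> \<le> S" using r1 by (simp add: gap_def Pr S_def)
  have zm: "gap \<phi> \<zeta> q m \<le> K * gap \<phi> m r \<zeta>" "gap \<phi> m r \<zeta> \<le> K * gap \<phi> \<zeta> q m"
    using Q q r m\<zeta>' unfolding gap_quasisymmetric_def by blast+
  have "gap \<phi> \<zeta> q m \<le> K * S"
    using zm(1) mult_left_mono[OF mz, of K] K by linarith
  then have zm': "(K + 2) * gap \<phi> \<zeta> q m \<le> (K + 2) * (K * S)" using K by (intro mult_left_mono) auto
  \<comment> \<open>The way from \<open>\<zeta>\<close> to \<open>\<eta>\<close> is halved at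
    \<open>m\<close>; the bracket is \<open>(r - q) \<bullet> u\<close> and corrects the slope on
    the second half. The first gap is at most \<open>S\<close>, the others at most
    \<open>K + 2\<close> times \<open>gap \<phi> \<zeta> q m\<close>.\<close>
  have "gap \<phi> \<zeta> q \<eta> = gap \<phi> m r \<eta> + gap \<phi> \<zeta> q m + (gap \<phi> \<zeta> q m + gap \<phi> m r \<zeta>)"
    by (simp add: gap_def Pr inner_simps)
  also have "\<dots> \<le> (1 + K * (K + 2)) * S"
    using me zm(2) zm' by (simp add: algebra_simps)
  also have "\<dots> < (1 + K * (K + 2)) * (2 * s)"
    using S K by (intro mult_strict_left_mono) (auto intro!: add_pos_pos)
  finally have "gap \<phi> \<zeta> q \<eta> < 2 * (1 + K * (K + 2)) * s" by (simp add: algebra_simps)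
  then show "\<eta> \<in> H_section \<phi> \<zeta> q (2 * (1 + K * (K + 2)) * s) \<inter> hplane \<xi>"
    using \<eta> by (simp add: H_section_gap)
qed

text \<open>If \<open>p \<noteq> q\<close> are subgradients at \<open>\<xi>\<close>, then the slopes \<open>a t\<close> in direction \<open>q - p\<close> drop by a fixed
  amount each time \<open>t\<close> is halved, although they are bounded below.\<close>

lemma gap_quasisymmetric_subdiff_unique:
  fixes \<phi> :: "'n::finite heis \<Rightarrow> real"
  assumes H: "H_convex \<phi>" and Q: "gap_quasisymmetric \<phi> K" and K: "K > 0"
    and p: "p \<in> H_subdiff \<phi> \<xi>" and q: "q \<in> H_subdiff \<phi> \<xi>"
  shows "p = q"
proof (rule ccontr)
  assume "p \<noteq> q"
  define v where "v = q - p"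
  define c where "c = v \<bullet> v"
  have c: "c > 0" using \<open>p \<noteq> q\<close> by (simp add: c_def v_def)
  define z where "z t = \<xi> \<odot> hexp (t *\<^sub>R v)" for t
  define a where "a t = (\<phi> (z t) - \<phi> \<xi>) / t" for t
  have low: "q \<bullet> v \<le> a t" if "t > 0" for t
    using H_subdiffD[OF q, of "t *\<^sub>R v"] that by (simp add: a_def z_def field_simps)
  have halve: "a t \<le> a (2 * t) - c / (2 * K)" if t: "t > 0" for t
  proof -
    obtain r where r: "r \<in> H_subdiff \<phi> (z t)" using H_subdiff_nonempty[OF H] by blast
    have "z t \<in> hplane \<xi>" by (simp add: z_def)
    then have "gap \<phi> \<xi> p (z t) \<le> K * gap \<phi> (z t) r \<xi>"
      using Q p r hplane_sym unfolding gap_quasisymmetric_def by blast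
    \<comment> \<open>The subgradient \<open>q\<close> lies above \<open>p\<close> by
      \<open>t * c\<close> along this line.\<close>
    moreover have "gap \<phi> \<xi> p (z t) \<ge> t * c"
      using H_subdiffD[OF q, of "t *\<^sub>R v"]
      by (simp add: gap_def z_def c_def v_def inner_simps algebra_simps)
    ultimately have "t * c \<le> K * (\<phi> \<xi> - \<phi> (z t) + t * (r \<bullet> v))"
      by (simp add: gap_def z_def)
    \<comment> \<open>Thus the slope of \<open>r\<close> at \<open>z t\<close> exceeds
      \<open>a t\<close> by \<open>c / K\<close>. From \<open>t\<close> to \<open>2 * t\<close> the
      function grows at least with that slope, and averaging the two halves yields half the
      excess.\<close>
    then have "t * (c / K) \<le> \<phi> \<xi> - \<phi> (z t) + t * (r \<bullet> v)"
      using K by (simp add: field_simps)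
    moreover have "z t \<odot> hexp (t *\<^sub>R v) = z (2 * t)"
      unfolding z_def hmult_hexp_hexp_scaled by simp
    then have "\<phi> (z t) + t * (r \<bullet> v) \<le> \<phi> (z (2 * t))"
      using H_subdiffD[OF r, of "t *\<^sub>R v"] by simp
    moreover have "2 * (y - x) + e \<le> y' - x" if "e \<le> x - y + w" "y + w \<le> y'" for e w x y y' :: real
      using that by (simp add: algebra_simps)
    ultimately have "2 * (\<phi> (z t) - \<phi> \<xi>) + t * (c / K) \<le> \<phi> (z (2 * t)) - \<phi> \<xi>" by blast
    then have "(2 * (\<phi> (z t) - \<phi> \<xi>) + t * (c / K)) / (2 * t) \<le> a (2 * t)"
      unfolding a_def using t by (intro divide_right_mono) auto
    moreover have "(2 * (\<phi> (z t) - \<phi> \<xi>) + t * (c / K)) / (2 * t) = a t + c / (2 * K)"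
      using t K by (simp add: a_def field_simps)
    ultimately show ?thesis by simp
  qed
  have "a (1 / 2 ^ n) \<le> a 1 - n * (c / (2 * K))" for n :: nat
  proof (induction n)
    case (Suc n)
    have "2 * (1 / 2 ^ Suc n) = (1 / 2 ^ n :: real)" by simp
    then have "a (1 / 2 ^ Suc n) \<le> a (1 / 2 ^ n) - c / (2 * K)"
      using halve[of "1 / 2 ^ Suc n"] by (simp del: power_Suc)
    moreover have "real (Suc n) * (c / (2 * K)) = n * (c / (2 * K)) + c / (2 * K)"
      by (simp only: of_nat_Suc distrib_right mult_1 add.commute)
    ultimately show ?case using Suc by linarith
  qed simp
  then have "real n * (c / (2 * K)) \<le> a 1 - q \<bullet> v" for n
    using low[of "1 / 2 ^ n"] by (smt (verit) zero_less_divide_1_iff zero_less_power)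
  moreover obtain n where "real n * (c / (2 * K)) > a 1 - q \<bullet> v"
    using reals_Archimedean3[of "c / (2 * K)"] c K by auto
  ultimately show False by (meson not_less)
qed

section \<open>The cycle of implications\<close>

theorem proposition4p2:
  fixes \<phi> :: "'n::finite heis \<Rightarrow> real"
  assumes "strictly_H_convex \<phi>"
  defines "cond_i \<equiv> \<exists>K>1. engulfing \<phi> K"
    and "cond_ii \<equiv> \<exists>K'>1. \<forall>\<xi> \<xi>'. \<forall>p\<in>H_subdiff \<phi> \<xi>. \<forall>q\<in>H_subdiff \<phi> \<xi>'. \<forall>s>0.
           \<xi>' \<in> H_section \<phi> \<xi> p s \<longrightarrow> \<xi> \<in> H_section \<phi> \<xi>' q (K' * s)"
    and "cond_iii \<equiv> \<exists>K''>1. \<forall>\<xi>. \<forall>\<xi>'\<in>hplane \<xi>. \<forall>p\<in>H_subdiff \<phi> \<xi>. \<forall>q\<in>H_subdiff \<phi> \<xi>'.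
           (K'' + 1) / K'' * (\<phi> \<xi>' - \<phi> \<xi> - p \<bullet> (Pr1 \<xi>' - Pr1 \<xi>)) \<le> (q - p) \<bullet> (Pr1 \<xi>' - Pr1 \<xi>) \<and>
           (q - p) \<bullet> (Pr1 \<xi>' - Pr1 \<xi>) \<le> (K'' + 1) * (\<phi> \<xi>' - \<phi> \<xi> - p \<bullet> (Pr1 \<xi>' - Pr1 \<xi>))"
  shows "(cond_i \<longleftrightarrow> cond_ii) \<and> (cond_ii \<longleftrightarrow> cond_iii) \<and>
         (cond_i \<or> cond_ii \<or> cond_iii \<longrightarrow> H_differentiable \<phi>)"
proof -
  have H: "H_convex \<phi>" using assms(1) by (simp add: strictly_H_convex_def)
  \<comment> \<open>All conditions meet in \<open>gap_quasisymmetric\<close>: (i) gives (ii), (ii)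
    gives quasisymmetry, which is equivalent to (iii) and implies both (i) and
    differentiability.\<close>
  have "cond_ii" if "cond_i"
    using that engulfing_imp_section_symmetric unfolding cond_i_def cond_ii_def by blast
  moreover have ii: "\<exists>K>1. gap_quasisymmetric \<phi> K" if ii: "cond_ii"
  proof -
    obtain K where "K > 1" and S: "\<And>\<xi> \<zeta> p q s. p \<in> H_subdiff \<phi> \<xi> \<Longrightarrow> q \<in> H_subdiff \<phi> \<zeta> \<Longrightarrow> s > 0 \<Longrightarrow>
        \<zeta> \<in> H_section \<phi> \<xi> p s \<Longrightarrow> \<xi> \<in> H_section \<phi> \<zeta> q (K * s)"
      using ii unfolding cond_ii_def by blast
    then show ?thesis using gap_quasisymmetric_of_sections[of K \<phi>] by force
  qed
  moreover have iii: "cond_iii \<longleftrightarrow> (\<exists>K>1. gap_quasisymmetric \<phi> K)"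
  proof -
    have "K > 1 \<and> gap_quasisymmetric \<phi> K \<longleftrightarrow> K > 1 \<and> (\<forall>\<xi>. \<forall>\<zeta>\<in>hplane \<xi>. \<forall>p\<in>H_subdiff \<phi> \<xi>. \<forall>q\<in>H_subdiff \<phi> \<zeta>.
      (K + 1) / K * gap \<phi> \<xi> p \<zeta> \<le> (q - p) \<bullet> (Pr1 \<zeta> - Pr1 \<xi>) \<and>
      (q - p) \<bullet> (Pr1 \<zeta> - Pr1 \<xi>) \<le> (K + 1) * gap \<phi> \<xi> p \<zeta>)" for K
      by (rule conj_cong[OF refl gap_quasisymmetric_iff]) simp
    then show ?thesis unfolding cond_iii_def gap_def by (simp only:)
  qed
  moreover have "cond_i" if g: "\<exists>K>1. gap_quasisymmetric \<phi> K"
  proof -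
    obtain K where K: "K > 1" "gap_quasisymmetric \<phi> K" using g by blast
    then have "engulfing \<phi> (2 * (1 + K * (K + 2)))"
      by (intro gap_quasisymmetric_imp_engulfing[OF H]) auto
    moreover have "2 * (1 + K * (K + 2)) > 1"
      using mult_pos_pos[of K "K + 2"] K(1) by (simp add: distrib_left)
    ultimately show ?thesis unfolding cond_i_def by blast
  qed
  moreover have "H_differentiable \<phi>" if g: "\<exists>K>1. gap_quasisymmetric \<phi> K"
  proof -
    obtain K where K: "K > 1" "gap_quasisymmetric \<phi> K" using g by blast
    have "\<exists>g. H_subdiff \<phi> \<xi> = {g}" for \<xi>
    proof -
      obtain g where "g \<in> H_subdiff \<phi> \<xi>" using H_subdiff_nonempty[OF H] by blast
      moreover have "p = g" if "p \<in> H_subdiff \<phi> \<xi>" for p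
        using gap_quasisymmetric_subdiff_unique[OF H K(2) _ that \<open>g \<in> H_subdiff \<phi> \<xi>\<close>] K(1) by simp
      ultimately show ?thesis by blast
    qed
    then show ?thesis by (rule H_differentiable_of_singleton_subdiff[OF H])
  qed
  ultimately show ?thesis by blast
qed

end
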